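(* Let $1 < q \le 2$ and $p=q/(q-1)$. Let $\{t_n\}_{n=1}^\infty$ be a weakness sequence, $\{\delta_n\}_{n=0}^\infty\in\ell_1$ a perturbation sequence, and $\{\eta_n\}_{n=1}^\infty\in\ell_1$ an error sequence. Then the AWCGA with these sequences converges for every Banach space $X \in \mathcal{P}_q$, every dictionary $\mathcal{D}$ in $X$, and every element $f \in X$ if and only if $$\sum_{n=1}^\infty t_n^p=\infty.$$
   Context: Banach spaces are real. The modulus of smoothness of $X$ is $\rho(u) = \sup_{\|x\|=\|y\|=1} \frac{\|x+uy\|+\|x-uy\|}{2} - 1$. For $1<q\le 2$, $\mathcal{P}_q$ is the class of all Banach spaces whose modulus of smoothness satisfies $\rho(u) \le \gamma u^q$ (for all $u \geq 0$) for some $\gamma>0$. A dictionary in $X$ is a set $\mathcal{D}\subset X$ with $\|g\|=1$ for all $g\in\mathcal{D}$ and $\overline{\mathrm{span}}\,\mathcal{D}=X$; dictionaries are assumed symmetric ($g\in\mathcal{D}$ implies $-g\in\mathcal{D}$). A weakness sequence $\{t_n\}_{n\ge1}$ has $0\le t_n\le1$; a perturbation sequence $\{\delta_n\}_{n\ge0}$ has $0\le\delta_n\le1$; an error sequence $\{\eta_n\}_{n\ge1}$ has $\eta_n\ge0$. Approximate Weak Chebyshev Greedy Algorithm (AWCGA) of $f\in X$ with these sequences: set $f_0=f$, and for $n\ge1$: (1) take any bounded linear functional $F_{n-1}$ on $X$ with $\|F_{n-1}\|\le1$ and $F_{n-1}(f_{n-1})\ge(1-\delta_{n-1})\|f_{n-1}\|$,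 and any $\phi_n\in\mathcal{D}$ with $F_{n-1}(\phi_n)\ge t_n\sup_{g\in\mathcal{D}}F_{n-1}(g)$; (2) let $\Phi_n=\mathrm{span}\{\phi_1,\dots,\phi_n\}$, $E_n=\inf_{G\in\Phi_n}\|f-G\|$, and take any $G_n\in\Phi_n$ with $\|f-G_n\|\le(1+\eta_n)E_n$; (3) set $f_n=f-G_n$. Any sequence of admissible choices is a realization. The AWCGA of $f$ converges if $\|f_n\|\to0$ for every realization; it diverges (does not converge) if there is a realization with $\|f_n\|\not\to0$. *)

theory Defs
  imports "HOL-Analysis.Analysis"
begin

text \<open>
  The theorem quantifies over all Banach spaces on one side of an equivalence, which a type of
  class banach cannot express. A Banach space is therefore a pair of a linear subspace \<open>S\<close> of
  some real vector space and a norm \<open>N\<close> on \<open>S\<close>, complete for \<open>N\<close>. Only the linear structure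
  of the surrounding type is used; the values of \<open>N\<close> and of functionals outside \<open>S\<close> are
  irrelevant.
\<close>

definition norm_on :: "'v::real_vector set \<Rightarrow> ('v \<Rightarrow> real) \<Rightarrow> bool" where
  "norm_on S N \<longleftrightarrow>
     (\<forall>x\<in>S. 0 \<le> N x) \<and>
     (\<forall>x\<in>S. N x = 0 \<longleftrightarrow> x = 0) \<and>
     (\<forall>c. \<forall>x\<in>S. N (c *\<^sub>R x) = \<bar>c\<bar> * N x) \<and>
     (\<forall>x\<in>S. \<forall>y\<in>S. N (x + y) \<le> N x + N y)"

definition complete_on :: "'v::real_vector set \<Rightarrow> ('v \<Rightarrow> real) \<Rightarrow> bool" where
  "complete_on S N \<longleftrightarrow>
     (\<forall>\<sigma>::nat \<Rightarrow> 'v.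
        (\<forall>n. \<sigma> n \<in> S) \<and> (\<forall>\<epsilon>>0. \<exists>M. \<forall>m\<ge>M. \<forall>n\<ge>M. N (\<sigma> m - \<sigma> n) < \<epsilon>) \<longrightarrow>
        (\<exists>x\<in>S. (\<lambda>n. N (\<sigma> n - x)) \<longlonglongrightarrow> 0))"

definition banach_space_on :: "'v::real_vector set \<Rightarrow> ('v \<Rightarrow> real) \<Rightarrow> bool" where
  "banach_space_on S N \<longleftrightarrow> subspace S \<and> norm_on S N \<and> complete_on S N"

definition closure_on :: "'v::real_vector set \<Rightarrow> ('v \<Rightarrow> real) \<Rightarrow> 'v set \<Rightarrow> 'v set" where
  "closure_on S N A = {x\<in>S. \<forall>\<epsilon>>0. \<exists>y\<in>A. N (x - y) < \<epsilon>}"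

definition bounded_functional_on :: "'v::real_vector set \<Rightarrow> ('v \<Rightarrow> real) \<Rightarrow> ('v \<Rightarrow> real) \<Rightarrow> bool" where
  "bounded_functional_on S N F \<longleftrightarrow>
     (\<forall>x\<in>S. \<forall>y\<in>S. F (x + y) = F x + F y) \<and>
     (\<forall>c. \<forall>x\<in>S. F (c *\<^sub>R x) = c * F x) \<and>
     (\<exists>K. \<forall>x\<in>S. \<bar>F x\<bar> \<le> K * N x)"

definition dual_norm_on :: "'v::real_vector set \<Rightarrow> ('v \<Rightarrow> real) \<Rightarrow> ('v \<Rightarrow> real) \<Rightarrow> real" where
  "dual_norm_on S N F = (SUP x\<in>{x\<in>S. N x \<le> 1}. \<bar>F x\<bar>)"

text \<open>
  On the zero space the supremum below is over the empty set. This is harmless: the zero space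
  has only the empty dictionary, for which the algorithm has no realizations.
\<close>

definition modulus_of_smoothness :: "'v::real_vector set \<Rightarrow> ('v \<Rightarrow> real) \<Rightarrow> real \<Rightarrow> real" where
  "modulus_of_smoothness S N u =
     (SUP (x, y)\<in>{x\<in>S. N x = 1} \<times> {y\<in>S. N y = 1}.
        (N (x + u *\<^sub>R y) + N (x - u *\<^sub>R y)) / 2 - 1)"

definition smooth_class :: "real \<Rightarrow> 'v::real_vector set \<Rightarrow> ('v \<Rightarrow> real) \<Rightarrow> bool" where
  "smooth_class q S N \<longleftrightarrow>
     banach_space_on S N \<and> (\<exists>\<gamma>>0. \<forall>u\<ge>0. modulus_of_smoothness S N u \<le> \<gamma> * u powr q)"

definition dictionary :: "'v::real_vector set \<Rightarrow> ('v \<Rightarrow> real) \<Rightarrow> 'v set \<Rightarrow> bool" where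
  "dictionary S N D \<longleftrightarrow>
     D \<subseteq> S \<and> (\<forall>g\<in>D. N g = 1) \<and> closure_on S N (span D) = S \<and> (\<forall>g\<in>D. - g \<in> D)"

text \<open>
  The value at index 0 of \<open>t\<close>, \<open>\<eta>\<close>, \<open>\<phi>\<close> and \<open>G\<close> is never used.
\<close>

definition weakness_sequence :: "(nat \<Rightarrow> real) \<Rightarrow> bool" where
  "weakness_sequence t \<longleftrightarrow> (\<forall>n\<ge>1. 0 \<le> t n \<and> t n \<le> 1)"

definition perturbation_sequence :: "(nat \<Rightarrow> real) \<Rightarrow> bool" where
  "perturbation_sequence \<delta> \<longleftrightarrow> (\<forall>n. 0 \<le> \<delta> n \<and> \<delta> n \<le> 1)"

definition error_sequence :: "(nat \<Rightarrow> real) \<Rightarrow> bool" where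
  "error_sequence \<eta> \<longleftrightarrow> (\<forall>n\<ge>1. 0 \<le> \<eta> n)"

definition awcga_realization ::
  "(nat \<Rightarrow> real) \<Rightarrow> (nat \<Rightarrow> real) \<Rightarrow> (nat \<Rightarrow> real) \<Rightarrow>
   'v::real_vector set \<Rightarrow> ('v \<Rightarrow> real) \<Rightarrow> 'v set \<Rightarrow> 'v \<Rightarrow>
   (nat \<Rightarrow> 'v \<Rightarrow> real) \<Rightarrow> (nat \<Rightarrow> 'v) \<Rightarrow> (nat \<Rightarrow> 'v) \<Rightarrow> (nat \<Rightarrow> 'v) \<Rightarrow> bool" where
  "awcga_realization t \<delta> \<eta> S N D f F \<phi> G r \<longleftrightarrow>
     r 0 = f \<and>
     (\<forall>n\<ge>1.
        bounded_functional_on S N (F (n - 1)) \<and>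
        dual_norm_on S N (F (n - 1)) \<le> 1 \<and>
        F (n - 1) (r (n - 1)) \<ge> (1 - \<delta> (n - 1)) * N (r (n - 1)) \<and>
        \<phi> n \<in> D \<and>
        F (n - 1) (\<phi> n) \<ge> t n * (SUP g\<in>D. F (n - 1) g) \<and>
        G n \<in> span (\<phi> ` {1..n}) \<and>
        N (f - G n) \<le> (1 + \<eta> n) * (INF g\<in>span (\<phi> ` {1..n}). N (f - g)) \<and>
        r n = f - G n)"

definition awcga_converges ::
  "(nat \<Rightarrow> real) \<Rightarrow> (nat \<Rightarrow> real) \<Rightarrow> (nat \<Rightarrow> real) \<Rightarrow>
   'v::real_vector set \<Rightarrow> ('v \<Rightarrow> real) \<Rightarrow> 'v set \<Rightarrow> 'v \<Rightarrow> bool" where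
  "awcga_converges t \<delta> \<eta> S N D f \<longleftrightarrow>
     (\<forall>F \<phi> G r. awcga_realization t \<delta> \<eta> S N D f F \<phi> G r \<longrightarrow> (\<lambda>n. N (r n)) \<longlonglongrightarrow> 0)"

text \<open>
  The vector space whose subspaces carry the Banach spaces quantified over. The first factor is
  arbitrary, so no Banach space is excluded for being too large (\<open>banach_in_universe\<close> below). The
  second factor only makes sure that the universe is never too small: every separable Banach
  space embeds linearly into the bounded sequences. The norm of the product is not used.
\<close>

type_synonym 'a universe = "'a \<times> (nat \<Rightarrow>\<^sub>C real)"

lemma banach_space_on_UNIV: "banach_space_on (UNIV :: 'a::banach set) norm"
proof -
  have "\<exists>x. (\<lambda>n. norm (\<sigma> n - x)) \<longlonglongrightarrow> 0"
    if "\<forall>\<epsilon>>0. \<exists>M. \<forall>m\<ge>M. \<forall>n\<ge>M. norm (\<sigma> m - \<sigma> n) < \<epsilon>" for \<sigma> :: "nat \<Rightarrow> 'a"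
  proof -
    from that have "Cauchy \<sigma>" by (simp add: Cauchy_iff)
    then obtain x where x: "\<sigma> \<longlonglongrightarrow> x" by (auto simp: Cauchy_convergent_iff convergent_def)
    show ?thesis using tendsto_norm_zero[OF LIM_zero[OF x]] by blast
  qed
  then show ?thesis
    by (auto simp: banach_space_on_def norm_on_def complete_on_def norm_triangle_ineq)
qed

lemma banach_in_universe:
  "banach_space_on (UNIV \<times> {0} :: ('a::banach) universe set) (\<lambda>z. norm (fst z))"
proof -
  have "\<exists>x. (\<lambda>n. norm (fst (\<sigma> n) - x)) \<longlonglongrightarrow> 0"
    if "\<forall>\<epsilon>>0. \<exists>M. \<forall>m\<ge>M. \<forall>n\<ge>M. norm (fst (\<sigma> m) - fst (\<sigma> n)) < \<epsilon>"
    for \<sigma> :: "nat \<Rightarrow> 'a universe"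
    using banach_space_on_UNIV[where 'a = 'a] that
    unfolding banach_space_on_def complete_on_def
    by (auto dest: spec[of _ "\<lambda>n. fst (\<sigma> n)"])
  moreover have "subspace (UNIV \<times> {0} :: 'a universe set)"
    by (auto simp: subspace_def zero_prod_def)
  ultimately show ?thesis
    by (auto simp: banach_space_on_def norm_on_def complete_on_def norm_triangle_ineq zero_prod_def)
qed

end

theory Submission
  imports Defs
begin

text \<open>
  Let \<open>E n\<close> be the distance from \<open>f\<close> to the span of the first \<open>n\<close> chosen elements and \<open>r n\<close> the
  \<open>n\<close>-th residual, whose norm is at most \<open>(1 + \<eta> n) * E n\<close>. A functional \<open>F\<close> that almost
  norms \<open>r n\<close> forces the norm of \<open>r n + y\<close> up to about \<open>N (r n) + F y\<close>, and smoothness then pushes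
  the norm of \<open>r n - y\<close> down to about \<open>N (r n) - F y\<close>, up to a term of order \<open>N y powr q\<close>
  (\<open>norm_diff_le_peak_functional\<close>). Subtracting a multiple of the next dictionary element, with the length of \<open>optimal_step_length\<close>, therefore
  lowers the error by a multiple of \<open>(t n * \<sigma>) powr p\<close>, where \<open>\<sigma>\<close> is the supremum of the functional
  over the dictionary.

  Convergence when the series of the \<open>t n powr p\<close> diverges: if \<open>E n\<close> stays above some \<open>\<alpha> > 0\<close>, the
  suprema stay above some \<open>\<beta> > 0\<close>, so the gains add up to infinity while the losses caused by
  \<open>\<delta>\<close> and \<open>\<eta>\<close> have a finite sum; but a nonnegative quantity cannot decrease by an infinite amount
  (\<open>awcga_converges_if_not_summable\<close>).

  Divergence when the series converges: in the space of \<open>q\<close>-summable sequences, which has modulus of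
  smoothness at most \<open>u powr q\<close> (\<open>ell_smooth\<close>), take the signed unit vectors as the dictionary and the
  element with coordinates \<open>1\<close> and \<open>t k powr (1 / (q - 1))\<close>, \<open>k \<ge> 1\<close>. Its norm is finite exactly
  because the series converges. The norming functional of a residual that still has the coordinate
  \<open>1\<close> at index 0 takes, at each unit vector \<open>k\<close> not yet chosen, the value \<open>t k\<close> times its value at
  the unit vector 0.
  So the algorithm may choose the unit vectors 1, 2, 3, and so on, and never touch index 0, which
  keeps all residuals at norm at least 1 (\<open>awcga_diverges_if_summable\<close>). This realization makes no
  errors, so it is admissible for all \<open>\<delta>\<close> and \<open>\<eta>\<close>.
\<close>

section \<open>Norms and functionals on a subspace\<close>

locale normed_subspace =
  fixes S :: "'v::real_vector set" and N :: "'v \<Rightarrow> real"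
  assumes subspace: "subspace S" and norm_on: "norm_on S N"
begin

lemma norm_nonneg: "x \<in> S \<Longrightarrow> 0 \<le> N x"
  and norm_eq_0_iff: "x \<in> S \<Longrightarrow> N x = 0 \<longleftrightarrow> x = 0"
  and norm_scale: "x \<in> S \<Longrightarrow> N (c *\<^sub>R x) = \<bar>c\<bar> * N x"
  and norm_triangle: "x \<in> S \<Longrightarrow> y \<in> S \<Longrightarrow> N (x + y) \<le> N x + N y"
  using norm_on by (auto simp: norm_on_def)

lemma norm_minus: "x \<in> S \<Longrightarrow> N (- x) = N x"
  using norm_scale[of x "-1"] by simp

lemma norm_triangle_diff: "x \<in> S \<Longrightarrow> y \<in> S \<Longrightarrow> N (x - y) \<le> N x + N y"
  using norm_triangle[of x "- y"] subspace by (simp add: norm_minus subspace_neg)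

lemma norm_pos: "x \<in> S \<Longrightarrow> x \<noteq> 0 \<Longrightarrow> 0 < N x"
  using norm_nonneg norm_eq_0_iff by (metis order_le_less)

lemma functional_diff:
  assumes "bounded_functional_on S N F" "x \<in> S" "y \<in> S"
  shows "F (x - y) = F x - F y"
proof -
  have "F (x + (-1) *\<^sub>R y) = F x + (-1) * F y"
    using assms subspace by (metis bounded_functional_on_def subspace_scale)
  then show ?thesis by simp
qed

lemma functional_le_norm:
  assumes F: "bounded_functional_on S N F" and le: "dual_norm_on S N F \<le> 1" and x: "x \<in> S"
  shows "\<bar>F x\<bar> \<le> N x"
proof (cases "x = 0")
  case True
  have "F (0 *\<^sub>R x) = 0 * F x" using F x by (meson bounded_functional_on_def)
  with True x show ?thesis using norm_nonneg[OF x] by simp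
next
  case False
  define y where "y = (1 / N x) *\<^sub>R x"
  have pos: "0 < N x" using x False by (rule norm_pos)
  have y: "y \<in> S" "N y = 1"
    using x pos subspace by (auto simp: y_def norm_scale subspace_scale)
  obtain K where K: "\<And>z. z \<in> S \<Longrightarrow> \<bar>F z\<bar> \<le> K * N z"
    using F unfolding bounded_functional_on_def by blast
  have "\<bar>F z\<bar> \<le> \<bar>K\<bar>" if "z \<in> S" "N z \<le> 1" for z
    using K[OF that(1)] norm_nonneg[OF that(1)] that(2)
    by (smt (verit) mult_left_le mult_right_mono)
  then have "bdd_above ((\<lambda>z. \<bar>F z\<bar>) ` {z \<in> S. N z \<le> 1})" by (auto intro!: bdd_aboveI)
  then have "\<bar>F y\<bar> \<le> dual_norm_on S N F"
    unfolding dual_norm_on_def using y by (intro cSUP_upper) auto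
  then have "\<bar>F y\<bar> \<le> 1" using le by simp
  moreover have "F y = F x / N x"
    using F x by (simp add: y_def bounded_functional_on_def)
  ultimately show ?thesis using pos by (simp add: field_simps abs_divide)
qed

text \<open>
  A combination of dictionary elements sees a functional only through its values on the
  dictionary, so its coefficients bound the functional once and for all. Symmetry of the
  dictionary is what makes the one-sided supremum control both signs.
\<close>
lemma functional_le_sup_dictionary:
  assumes D: "dictionary S N D" and h: "h \<in> span D"
  obtains A where "0 \<le> A" "\<And>F. bounded_functional_on S N F \<Longrightarrow> dual_norm_on S N F \<le> 1 \<Longrightarrow>
           \<bar>F h\<bar> \<le> A * (SUP g\<in>D. F g)"
proof -
  have DS: "D \<subseteq> S" and D1: "\<And>g. g \<in> D \<Longrightarrow> N g = 1" and Dm: "\<And>g. g \<in> D \<Longrightarrow> - g \<in> D"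
    using D by (auto simp: dictionary_def)
  have sup: "\<bar>F g\<bar> \<le> (SUP g\<in>D. F g)"
    if F: "bounded_functional_on S N F" "dual_norm_on S N F \<le> 1" and g: "g \<in> D" for F g
  proof -
    have "F h \<le> 1" if "h \<in> D" for h
      using functional_le_norm[OF F, of h] D1[OF that] DS that by (auto simp: abs_le_iff)
    then have bdd: "bdd_above (F ` D)" by (auto intro!: bdd_aboveI)
    have "F (0 - g) = F 0 - F g" using F g DS subspace by (intro functional_diff) (auto simp: subspace_0)
    moreover have "F 0 = 0" using functional_le_norm[OF F, of 0] subspace norm_eq_0_iff[of 0]
      by (simp add: subspace_0)
    ultimately have "F (- g) = - F g" by simp
    then show ?thesis using cSUP_upper[OF g bdd] cSUP_upper[OF Dm[OF g] bdd] by simp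
  qed
  have "h \<in> S \<and> (\<exists>A\<ge>0. \<forall>F. bounded_functional_on S N F \<longrightarrow> dual_norm_on S N F \<le> 1 \<longrightarrow>
           \<bar>F h\<bar> \<le> A * (SUP g\<in>D. F g))"
    using h
  proof (induction rule: span_induct_alt)
    case base
    have "F 0 = 0" if "bounded_functional_on S N F" "dual_norm_on S N F \<le> 1" for F
      using functional_le_norm[OF that, of 0] subspace norm_eq_0_iff[of 0]
      by (simp add: subspace_0)
    then show ?case using subspace by (auto simp: subspace_0 intro!: exI[of _ 0])
  next
    case (step c g y)
    then obtain A where y: "y \<in> S" and A: "A \<ge> 0" "\<And>F. bounded_functional_on S N F \<Longrightarrow> dual_norm_on S N F \<le> 1 \<Longrightarrow>
           \<bar>F y\<bar> \<le> A * (SUP g\<in>D. F g)" by blast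
    have "\<bar>F (c *\<^sub>R g + y)\<bar> \<le> (\<bar>c\<bar> + A) * (SUP g\<in>D. F g)"
      if F: "bounded_functional_on S N F" "dual_norm_on S N F \<le> 1" for F
    proof -
      have "F (c *\<^sub>R g + y) = c * F g + F y"
        using F(1) step(1) y DS subspace unfolding bounded_functional_on_def
        by (metis subsetD subspace_scale)
      then have "\<bar>F (c *\<^sub>R g + y)\<bar> \<le> \<bar>c\<bar> * \<bar>F g\<bar> + \<bar>F y\<bar>"
        by (simp add: abs_mult abs_triangle_ineq flip: abs_mult)
      also have "\<dots> \<le> \<bar>c\<bar> * (SUP g\<in>D. F g) + A * (SUP g\<in>D. F g)"
        by (intro add_mono mult_left_mono sup[OF F step(1)] A(2)[OF F]) auto
      finally show ?thesis by (simp add: distrib_right)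
    qed
    moreover have "c *\<^sub>R g + y \<in> S"
      using step(1) y DS subspace by (auto simp: subspace_add subspace_scale)
    ultimately show ?case using A(1) by (auto intro!: exI[of _ "\<bar>c\<bar> + A"])
  qed
  then show ?thesis using that by blast
qed

end

section \<open>Smoothness as a descent inequality\<close>

text \<open>
  A step of length \<open>s\<close> gains \<open>a * s\<close> and costs \<open>K * s powr q\<close>. At this length, which is optimal up
  to a constant, half of the gain survives.
\<close>
lemma optimal_step_length:
  fixes q a K :: real
  assumes q: "1 < q" and a: "0 \<le> a" and K: "0 < K"
  defines "s \<equiv> (a / (2 * K)) powr (1 / (q - 1))"
  shows "K * s powr q = s * a / 2"
proof -
  have "s powr q = s powr 1 * s powr (q - 1)" unfolding powr_add[symmetric] by simp
  also have "s powr (q - 1) = a / (2 * K)" using q a K by (simp add: s_def powr_powr)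
  finally show ?thesis using K by (simp add: s_def)
qed

locale smooth_space = normed_subspace S N for S :: "'v::real_vector set" and N +
  fixes q \<gamma> :: real
  assumes q: "1 < q" and \<gamma>: "0 < \<gamma>"
    and modulus: "\<And>u. 0 \<le> u \<Longrightarrow> modulus_of_smoothness S N u \<le> \<gamma> * u powr q"
begin

text \<open>
  By homogeneity, the bound on unit vectors extends to all \<open>x \<noteq> 0\<close> and \<open>y\<close>, with \<open>N y / N x\<close> in the
  role of \<open>u\<close>.
\<close>
lemma smooth_symmetric_sum:
  assumes x: "x \<in> S" "x \<noteq> 0" and y: "y \<in> S"
  shows "N (x + y) + N (x - y) \<le> 2 * N x * (1 + \<gamma> * (N y / N x) powr q)"
proof (cases "y = 0")
  case True
  then show ?thesis using norm_eq_0_iff[OF y] by simp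
next
  case False
  have px: "0 < N x" and py: "0 < N y" using x y False norm_pos by auto
  define a where "a = (1 / N x) *\<^sub>R x"
  define b where "b = (1 / N y) *\<^sub>R y"
  define u where "u = N y / N x"
  have u: "0 \<le> u" using px py by (simp add: u_def)
  have ab: "a \<in> S" "N a = 1" "b \<in> S" "N b = 1"
    using x y px py subspace by (auto simp: a_def b_def norm_scale subspace_scale)
  let ?m = "\<lambda>(a, b). (N (a + u *\<^sub>R b) + N (a - u *\<^sub>R b)) / 2 - 1"
  let ?B = "{x \<in> S. N x = 1} \<times> {y \<in> S. N y = 1}"
  have "?m z \<le> u" if z: "z \<in> ?B" for z
  proof -
    obtain a b where ab: "z = (a, b)" "a \<in> S" "b \<in> S" "N a = 1" "N b = 1"
      using z by auto
    then have ub: "u *\<^sub>R b \<in> S" using subspace by (simp add: subspace_scale)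
    show ?thesis
      using norm_triangle[OF ab(2) ub] norm_triangle_diff[OF ab(2) ub] ab u
      by (simp add: norm_scale field_simps)
  qed
  then have "bdd_above (?m ` ?B)" by (intro bdd_aboveI2)
  then have "?m (a, b) \<le> modulus_of_smoothness S N u"
    unfolding modulus_of_smoothness_def using ab by (intro cSUP_upper) auto
  also have "\<dots> \<le> \<gamma> * u powr q" by (rule modulus[OF u])
  finally have le: "N (a + u *\<^sub>R b) + N (a - u *\<^sub>R b) \<le> 2 * (1 + \<gamma> * u powr q)"
    by (simp add: field_simps)
  have "x + y = N x *\<^sub>R (a + u *\<^sub>R b)" "x - y = N x *\<^sub>R (a - u *\<^sub>R b)"
    using px py by (auto simp: a_def b_def u_def scaleR_add_right scaleR_diff_right)
  then have "N (x + y) + N (x - y) = N x * (N (a + u *\<^sub>R b) + N (a - u *\<^sub>R b))"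
    using ab px subspace by (simp add: norm_scale subspace_add subspace_diff subspace_scale distrib_left)
  also have "\<dots> \<le> N x * (2 * (1 + \<gamma> * u powr q))"
    using le px by (intro mult_left_mono) auto
  finally show ?thesis by (simp add: u_def mult_ac)
qed

text \<open>
  The functional forces \<open>N (x + y)\<close> to be large, and smoothness bounds the sum of \<open>N (x + y)\<close> and
  \<open>N (x - y)\<close>; hence \<open>N (x - y)\<close> must be small. A step of the algorithm is useful, and an almost
  best approximant is almost annihilated, for this one reason.
\<close>
lemma norm_diff_le_peak_functional:
  assumes F: "bounded_functional_on S N F" "dual_norm_on S N F \<le> 1"
    and peak: "(1 - d) * N x \<le> F x" and x: "x \<in> S" "x \<noteq> 0" and y: "y \<in> S"
  shows "N (x - y) \<le> N x * (1 + d + 2 * \<gamma> * (N y / N x) powr q) - F y"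
proof -
  have "F x + F y = F (x + y)" using F x y by (simp add: bounded_functional_on_def)
  also have "\<dots> \<le> N (x + y)"
    using functional_le_norm[OF F, of "x + y"] x y subspace by (simp add: subspace_add)
  finally show ?thesis using smooth_symmetric_sum[OF x y] peak by (simp add: algebra_simps)
qed

text \<open>
  The form in which the inequality is used: once the norms of the residuals lie between \<open>\<alpha>\<close> and
  \<open>M\<close>, the error term loses its dependence on the residual.
\<close>
lemma norm_diff_le_uniform:
  assumes F: "bounded_functional_on S N F" "dual_norm_on S N F \<le> 1"
    and peak: "(1 - d) * N x \<le> F x" and x: "x \<in> S" and y: "y \<in> S"
    and \<alpha>: "0 < \<alpha>" "\<alpha> \<le> N x" and M: "N x \<le> M" and d: "0 \<le> d"
  shows "N (x - y) \<le> N x + M * d + 2 * \<gamma> * \<alpha> powr (1 - q) * N y powr q - F y"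
proof -
  have px: "0 < N x" using \<alpha> by simp
  then have x0: "x \<noteq> 0" using norm_eq_0_iff[OF x] by auto
  have "N x * (N y / N x) powr q = N x powr (1 - q) * N y powr q"
    using px norm_nonneg[OF y] by (simp add: powr_divide powr_diff)
  also have "\<dots> \<le> \<alpha> powr (1 - q) * N y powr q"
    using \<alpha> q by (intro mult_right_mono powr_mono2') auto
  finally have "2 * \<gamma> * (N x * (N y / N x) powr q) \<le> 2 * \<gamma> * (\<alpha> powr (1 - q) * N y powr q)"
    using \<gamma> by (intro mult_left_mono) auto
  moreover have "N x * d \<le> M * d" using M d by (rule mult_right_mono)
  ultimately show ?thesis
    using norm_diff_le_peak_functional[OF F peak x x0 y] by (simp add: algebra_simps)
qed

text \<open>
  Suppose that the best approximation errors \<open>E n\<close> decrease to some \<open>\<alpha> > 0\<close>. Approximating \<open>f\<close> to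
  within \<open>\<alpha> / 4\<close> by a combination \<open>y\<close> of dictionary elements shows that the functionals keep a
  supremum of at least some \<open>\<beta> > 0\<close> over the dictionary, because they are large on \<open>r n\<close> and
  asymptotically negligible on \<open>G n\<close>. The descent inequality then makes step \<open>n + 1\<close> gain a
  multiple of \<open>t (n + 1) powr p\<close>, up to losses of order \<open>\<delta> n + \<eta> n\<close>. The gains telescope and the
  losses are summable, so the powers of \<open>t\<close> would be summable.
\<close>
theorem awcga_converges_if_not_summable:
  assumes D: "dictionary S N D" and f: "f \<in> S"
    and t: "weakness_sequence t"
    and \<delta>: "perturbation_sequence \<delta>" "summable \<delta>"
    and \<eta>: "error_sequence \<eta>" "summable (\<lambda>n. \<eta> (Suc n))"
    and div: "\<not> summable (\<lambda>n. t (Suc n) powr (q / (q - 1)))"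
  shows "awcga_converges t \<delta> \<eta> S N D f"
  unfolding awcga_converges_def
proof (intro allI impI)
  fix F \<phi> G r
  assume real: "awcga_realization t \<delta> \<eta> S N D f F \<phi> G r"
  define V where "V n = span (\<phi> ` {1..n})" for n :: nat
  define E where "E n = (INF g\<in>V n. N (f - g))" for n
  have F: "bounded_functional_on S N (F n)" "dual_norm_on S N (F n) \<le> 1"
    and peak: "(1 - \<delta> n) * N (r n) \<le> F n (r n)"
    and \<phi>: "\<phi> (Suc n) \<in> D" "t (Suc n) * (SUP g\<in>D. F n g) \<le> F n (\<phi> (Suc n))" for n
    using real[unfolded awcga_realization_def, THEN conjunct2, rule_format, of "Suc n"] by auto
  have G: "G n \<in> V n" and r: "r n = f - G n" and r_le: "N (r n) \<le> (1 + \<eta> n) * E n"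
    if "1 \<le> n" for n
    using real[unfolded awcga_realization_def, THEN conjunct2, rule_format, of n] that
    by (auto simp: V_def E_def)
  have r0: "r 0 = f" using real by (simp add: awcga_realization_def)
  have DS: "D \<subseteq> S" and D1: "\<And>g. g \<in> D \<Longrightarrow> N g = 1" using D by (auto simp: dictionary_def)
  have \<phi>D: "\<phi> n \<in> D" if "1 \<le> n" for n using \<phi>(1)[of "n - 1"] that by simp
  have VS: "V n \<subseteq> S" for n
    unfolding V_def using \<phi>D DS subspace by (intro span_minimal) auto
  have V_mono: "V n \<subseteq> V (Suc n)" for n
    unfolding V_def by (intro span_mono image_mono) auto
  have V0: "0 \<in> V n" for n by (simp add: V_def span_zero)
  have bdd: "bdd_below ((\<lambda>g. N (f - g)) ` V n)" for n
    using VS f subspace norm_nonneg by (intro bdd_belowI2[of _ 0]) (auto simp: subspace_diff subset_iff)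
  have E_le: "E n \<le> N (f - g)" if "g \<in> V n" for n g
    unfolding E_def using that bdd by (intro cINF_lower)
  have E_nonneg: "0 \<le> E n" for n
    unfolding E_def using V0[of n] VS f subspace norm_nonneg
    by (intro cINF_greatest) (auto simp: subspace_diff subset_iff)
  have E_dec: "decseq E"
    unfolding E_def using V_mono V0 bdd
    by (intro decseq_SucI cINF_superset_mono order_refl) blast+
  have \<eta>0: "0 \<le> \<eta> n" if "1 \<le> n" for n using \<eta>(1) that by (simp add: error_sequence_def)
  have \<delta>0: "0 \<le> \<delta> n" for n using \<delta>(1) by (simp add: perturbation_sequence_def)
  have t0: "0 \<le> t (Suc n)" for n using t by (simp add: weakness_sequence_def)
  have sum_\<eta>: "summable \<eta>" using \<eta>(2) by (simp add: summable_Suc_iff)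
  have \<eta>_lim: "\<eta> \<longlonglongrightarrow> 0" and \<delta>_lim: "\<delta> \<longlonglongrightarrow> 0"
    using sum_\<eta> \<delta>(2) by (auto intro: summable_LIMSEQ_zero)
  have E_r: "E n \<le> N (r n)" if "1 \<le> n" for n using E_le[OF G] r that by simp
  have rS: "r n \<in> S" for n
  proof (cases n)
    case (Suc m)
    then have "r n = f - G n" "G n \<in> S" using r G VS by (auto simp: subset_iff)
    then show ?thesis using f subspace by (simp add: subspace_diff)
  qed (use r0 f in simp)
  obtain \<alpha> where \<alpha>: "E \<longlonglongrightarrow> \<alpha>" "\<And>n. \<alpha> \<le> E n"
    using decseq_convergent[OF E_dec, of 0] E_nonneg by blast
  have r_lim: "(\<lambda>n. N (r n)) \<longlonglongrightarrow> \<alpha>"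
  proof (rule tendsto_sandwich[of E _ _ "\<lambda>n. (1 + \<eta> n) * E n"])
    show "(\<lambda>n. (1 + \<eta> n) * E n) \<longlonglongrightarrow> \<alpha>"
      using tendsto_mult[OF tendsto_add[OF tendsto_const[of 1] \<eta>_lim] \<alpha>(1)] by simp
  qed (use \<alpha>(1) E_r r_le in \<open>auto intro: eventually_sequentiallyI[of 1]\<close>)
  have "\<alpha> = 0"
  proof (rule ccontr)
    assume "\<alpha> \<noteq> 0"
    moreover have "0 \<le> \<alpha>" using \<alpha>(1) E_nonneg by (intro LIMSEQ_le_const) auto
    ultimately have \<alpha>0: "0 < \<alpha>" by simp
    obtain M where M: "0 < M" "\<And>n. N (r n) \<le> M"
      using Bseq_def[THEN iffD1, OF convergent_imp_Bseq[OF convergentI[OF r_lim]]]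
      by (auto simp: abs_le_iff)
    define K where "K = 2 * \<gamma> * \<alpha> powr (1 - q)"
    have K: "0 < K" using \<gamma> \<alpha>0 by (simp add: K_def)
    have descent: "N (r n - y) \<le> N (r n) + M * \<delta> n + K * N y powr q - F n y"
      if "1 \<le> n" "y \<in> S" for n y
      unfolding K_def using \<alpha>(2)[of n] E_r[of n] that \<alpha>0
      by (intro norm_diff_le_uniform F peak rS M \<delta>0) auto

    define L where "L = N f + M"
    have L: "0 < L" using norm_nonneg[OF f] M by (simp add: L_def)
    have GL: "G n \<in> S" "N (G n) \<le> L" if "1 \<le> n" for n
    proof -
      show "G n \<in> S" using G VS that by auto
      have "N (f - r n) \<le> N f + N (r n)" using f rS by (rule norm_triangle_diff)
      then show "N (G n) \<le> L" using r[OF that] M(2)[of n] by (simp add: L_def)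
    qed
    \<comment> \<open>\<open>F n\<close> is almost zero on \<open>V n\<close>: a step of fixed length \<open>l\<close> along \<open>G n\<close> cannot bring the error
        below \<open>E n\<close>, while the suboptimality \<open>h n\<close> of the residual tends to zero.\<close>
    define l where "l = (\<alpha> / 8 / (2 * (K * L powr q))) powr (1 / (q - 1))"
    have l: "0 < l" "K * L powr q * l powr q = l * (\<alpha> / 8) / 2"
      using K L \<alpha>0 q optimal_step_length[of q "\<alpha> / 8" "K * L powr q"] by (auto simp: l_def)
    define h where "h n = N (r n) - E n + M * \<delta> n" for n
    have "h \<longlonglongrightarrow> \<alpha> - \<alpha> + M * 0"
      unfolding h_def by (intro tendsto_intros r_lim \<alpha> \<delta>_lim)
    then have "\<forall>\<^sub>F n in sequentially. h n < l * (\<alpha> / 16)"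
      using l \<alpha>0 by (intro order_tendstoD) auto
    then have small: "\<forall>\<^sub>F n in sequentially. - (\<alpha> / 8) \<le> F n (G n)"
      using eventually_ge_at_top[of 1]
    proof eventually_elim
      case (elim n)
      let ?y = "(- l) *\<^sub>R G n"
      have y: "?y \<in> S" "N ?y = l * N (G n)"
        using GL[OF elim(2)] subspace l subspace_scale[OF subspace, of "G n" "- l"]
        by (auto simp: norm_scale norm_minus subspace_scale)
      have "r n - ?y = f - (1 - l) *\<^sub>R G n" using r elim by (simp add: algebra_simps)
      moreover have "(1 - l) *\<^sub>R G n \<in> V n" using G elim by (simp add: V_def span_scale)
      ultimately have "E n \<le> N (r n - ?y)" using E_le by simp
      also have "\<dots> \<le> N (r n) + M * \<delta> n + K * N ?y powr q - F n ?y"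
        using elim(2) y(1) by (rule descent)
      finally have "F n ?y \<le> h n + K * N ?y powr q" by (simp add: h_def)
      moreover have "F n ?y = - l * F n (G n)"
        using F(1)[of n] GL[OF elim(2)] unfolding bounded_functional_on_def by blast
      moreover have "K * N ?y powr q \<le> K * (L powr q * l powr q)"
        using K L l y(2) GL[OF elim(2)] q norm_nonneg
        by (auto simp: powr_mult[symmetric] mult.commute intro!: powr_mono2 mult_right_mono)
      ultimately have "l * - F n (G n) \<le> l * (\<alpha> / 8)" using elim(1) l by (simp add: mult_ac)
      then have "- F n (G n) \<le> \<alpha> / 8" using l(1) by (rule mult_left_le_imp_le)
      then show ?case by simp
    qed

    have "f \<in> closure_on S N (span D)" using D f by (simp add: dictionary_def)
    then obtain y where y: "y \<in> span D" "N (f - y) < \<alpha> / 4"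
      using \<alpha>0 unfolding closure_on_def by (auto dest: spec[of _ "\<alpha> / 4"])
    have yS: "y \<in> S" using y(1) DS subspace by (meson span_minimal subsetD)
    obtain A where A: "0 \<le> A"
      "\<And>F. bounded_functional_on S N F \<Longrightarrow> dual_norm_on S N F \<le> 1 \<Longrightarrow> \<bar>F y\<bar> \<le> A * (SUP g\<in>D. F g)"
      using functional_le_sup_dictionary[OF D y(1)] by blast
    have "\<forall>\<^sub>F n in sequentially. \<delta> n < 1 / 4" using \<delta>_lim by (intro order_tendstoD) auto
    with small have large: "\<forall>\<^sub>F n in sequentially. \<alpha> / 4 \<le> A * (SUP g\<in>D. F n g)"
      using eventually_ge_at_top[of 1]
    proof eventually_elim
      case (elim n)
      have "3 / 4 * \<alpha> \<le> (1 - \<delta> n) * N (r n)"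
        using elim(2) \<alpha>(2)[of n] E_r[OF elim(3)] \<alpha>0 by (intro mult_mono) auto
      also have "\<dots> \<le> F n (f - G n)" using peak[of n] by (simp only: r[OF elim(3)])
      also have "\<dots> = F n f - F n (G n)" using F f GL[OF elim(3)] by (simp add: functional_diff)
      finally have "\<alpha> / 2 \<le> F n f" using elim(1) \<alpha>0 by simp
      moreover have "F n f - F n y \<le> N (f - y)"
        using functional_le_norm[OF F, of "f - y" n] functional_diff[OF F(1) f yS] f yS subspace
        by (auto simp: abs_le_iff subspace_diff)
      ultimately show ?case using A(2)[OF F, of n] y(2) by (simp add: abs_le_iff)
    qed
    then obtain n where "\<alpha> / 4 \<le> A * (SUP g\<in>D. F n g)" by (auto simp: eventually_sequentially)
    then have A0: "0 < A" using A(1) \<alpha>0 by (cases "A = 0") auto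
    define \<beta> where "\<beta> = \<alpha> / (4 * A)"
    have \<beta>: "0 < \<beta>" using \<alpha>0 A0 by (simp add: \<beta>_def)

    define c where "c = \<beta> / 2 * (\<beta> / (2 * K)) powr (1 / (q - 1))"
    have c: "0 < c" using \<beta> K by (simp add: c_def)
    have "\<forall>\<^sub>F n in sequentially.
        norm (c * t (Suc n) powr (q / (q - 1))) \<le> (E n - E (Suc n)) + M * (\<delta> n + \<eta> n)"
      using large eventually_ge_at_top[of 1]
    proof eventually_elim
      case (elim n)
      let ?t = "t (Suc n)"
      define s where "s = (\<beta> * ?t / (2 * K)) powr (1 / (q - 1))"
      have s: "0 \<le> s" "K * s powr q = s * (\<beta> * ?t) / 2"
        using optimal_step_length[of q "\<beta> * ?t" K] q \<beta> t0 K by (auto simp: s_def)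
      have "s = (\<beta> / (2 * K)) powr (1 / (q - 1)) * ?t powr (1 / (q - 1))"
        using \<beta> t0[of n] K by (simp add: s_def powr_mult[symmetric])
      then have "s * (\<beta> * ?t) / 2 = c * (?t powr (1 / (q - 1)) * ?t powr 1)"
        using t0[of n] by (simp add: c_def)
      also have "?t powr (1 / (q - 1)) * ?t powr 1 = ?t powr (1 / (q - 1) + 1)"
        by (rule powr_add[symmetric])
      also have "1 / (q - 1) + 1 = q / (q - 1)" using q by (simp add: field_simps)
      finally have gain: "s * (\<beta> * ?t) / 2 = c * ?t powr (q / (q - 1))" .
      have "\<beta> \<le> (SUP g\<in>D. F n g)" using elim(1) A0 by (simp add: \<beta>_def field_simps)
      then have "\<beta> * ?t \<le> F n (\<phi> (Suc n))"
        using \<phi>(2)[of n] t0[of n] by (metis mult.commute mult_left_mono order_trans)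
      then have F\<phi>: "s * (\<beta> * ?t) \<le> F n (s *\<^sub>R \<phi> (Suc n))"
        using F(1)[of n] \<phi>(1) DS s(1) unfolding bounded_functional_on_def
        by (metis mult_left_mono subsetD)
      have \<phi>S: "s *\<^sub>R \<phi> (Suc n) \<in> S" "N (s *\<^sub>R \<phi> (Suc n)) = s"
        using \<phi>(1)[of n] DS D1 subspace s by (auto simp: norm_scale subspace_scale)
      have "\<phi> (Suc n) \<in> V (Suc n)" by (auto simp: V_def intro: span_base)
      then have "G n + s *\<^sub>R \<phi> (Suc n) \<in> V (Suc n)"
        using G[OF elim(2)] V_mono unfolding V_def by (meson span_add span_scale subsetD)
      then have "E (Suc n) \<le> N (r n - s *\<^sub>R \<phi> (Suc n))"
        using E_le r[OF elim(2)] by (metis diff_diff_eq)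
      also have "\<dots> \<le> N (r n) + M * \<delta> n + K * s powr q - F n (s *\<^sub>R \<phi> (Suc n))"
        using descent[OF elim(2) \<phi>S(1)] \<phi>S(2) by simp
      also have "\<dots> \<le> N (r n) + M * \<delta> n - c * ?t powr (q / (q - 1))"
        using s(2) gain F\<phi> by simp
      finally have "c * ?t powr (q / (q - 1)) \<le> N (r n) - E (Suc n) + M * \<delta> n" by simp
      moreover have "N (r n) \<le> E n + M * \<eta> n"
      proof -
        have "E n * \<eta> n \<le> M * \<eta> n"
          using E_r[OF elim(2)] M(2)[of n] \<eta>0[OF elim(2)] by (intro mult_right_mono) auto
        then show ?thesis using r_le[OF elim(2)] by (simp add: algebra_simps)
      qed
      ultimately show ?case using c by (simp add: algebra_simps)
    qed
    moreover have "summable (\<lambda>n. (E n - E (Suc n)) + M * (\<delta> n + \<eta> n))"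
      using \<delta>(2) sum_\<eta> by (intro summable_add summable_mult telescope_summable'[OF \<alpha>(1)])
    ultimately have "summable (\<lambda>n. c * t (Suc n) powr (q / (q - 1)))"
      by (rule summable_comparison_test_ev)
    then have "summable (\<lambda>n. t (Suc n) powr (q / (q - 1)))"
      using c by (simp add: summable_cmult_iff)
    with div show False by simp
  qed
  with r_lim show "(\<lambda>n. N (r n)) \<longlonglongrightarrow> 0" by simp
qed

end

section \<open>The sequence space of exponent \<open>q\<close>\<close>

lemma convex_powr_nonneg:
  fixes a b x y q :: real
  assumes q: "1 \<le> q" and nn: "0 \<le> a" "0 \<le> b" "a + b = 1" "0 \<le> x" "0 \<le> y"
  shows "(a * x + b * y) powr q \<le> a * x powr q + b * y powr q"
proof -
  \<comment> \<open>The boundary of the half-line is where convexity on the open half-line says nothing.\<close>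
  have zero: "(c * z) powr q \<le> c * z powr q" if "0 \<le> c" "c \<le> 1" "0 \<le> z" for c z
  proof -
    have "c powr q \<le> c" using powr_mono'[of 1 q c] that q by simp
    then show ?thesis using that by (simp add: powr_mult mult_right_mono)
  qed
  consider "x = 0" | "y = 0" | "0 < x" "0 < y" using nn by linarith
  then show ?thesis
  proof cases
    case 3
    then show ?thesis
      using convex_onD[OF powr_convex[OF q], of b x y] nn by (simp add: eq_diff_eq[symmetric])
  qed (use zero[of b y] zero[of a x] nn q in auto)
qed

lemma powr_le_powr_imp_le:
  fixes x y q :: real
  assumes "x powr q \<le> y powr q" "0 < q" "0 \<le> y"
  shows "x \<le> y"
  using assms powr_less_mono2[of q y x] by (meson not_le)

text \<open>After division by \<open>u + v\<close>: a number in the unit interval is at most its power.\<close>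
lemma powr_add_le_of_le_1:
  fixes u v s :: real
  assumes "0 \<le> u" "0 \<le> v" "0 < s" "s \<le> 1"
  shows "(u + v) powr s \<le> u powr s + v powr s"
proof (cases "u + v = 0")
  case True
  then show ?thesis using assms by simp
next
  case False
  then have uv: "0 < u + v" using assms by simp
  have le: "w \<le> w powr s" if "0 \<le> w" "w \<le> 1" for w
    using powr_mono'[of s 1 w] that assms by simp
  have "1 = u / (u + v) + v / (u + v)" using uv by (simp add: add_divide_distrib[symmetric])
  also have "\<dots> \<le> (u / (u + v)) powr s + (v / (u + v)) powr s"
    using assms uv by (intro add_mono le) auto
  also have "\<dots> = (u powr s + v powr s) / (u + v) powr s"
    using assms uv by (simp add: powr_divide add_divide_distrib)
  finally show ?thesis using uv by (simp add: field_simps)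
qed

text \<open>
  With \<open>s = q / 2 \<le> 1\<close> this is concavity of the power \<open>s\<close>, applied to \<open>(a + b)\<^sup>2\<close> and
  \<open>(a - b)\<^sup>2\<close>, whose mean is \<open>a\<^sup>2 + b\<^sup>2\<close>, followed by subadditivity of the power \<open>s\<close>.
\<close>
lemma powr_parallelogram_le:
  fixes a b q :: real
  assumes q: "0 < q" "q \<le> 2"
  shows "\<bar>a + b\<bar> powr q + \<bar>a - b\<bar> powr q \<le> 2 * (\<bar>a\<bar> powr q + \<bar>b\<bar> powr q)"
proof -
  define s where "s = q / 2"
  have s: "0 < s" "s \<le> 1" using q by (auto simp: s_def)
  have sq: "\<bar>x\<bar> powr q = (x\<^sup>2) powr s" for x :: real
  proof -
    have "(x\<^sup>2) powr s = (\<bar>x\<bar> powr 2) powr s" by simp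
    then show ?thesis by (simp only: powr_powr) (simp add: s_def)
  qed
  define u v where "u = \<bar>a + b\<bar> powr q" and "v = \<bar>a - b\<bar> powr q"
  have inv: "(\<bar>x\<bar> powr q) powr (1 / s) = x\<^sup>2" for x :: real
    using s by (simp add: sq powr_powr)
  have "(1 / 2 * u + 1 / 2 * v) powr (1 / s) \<le> 1 / 2 * u powr (1 / s) + 1 / 2 * v powr (1 / s)"
    using s by (intro convex_powr_nonneg) (auto simp: u_def v_def)
  also have "\<dots> = a\<^sup>2 + b\<^sup>2"
    unfolding u_def v_def inv by (simp add: power2_eq_square algebra_simps)
  finally have "((1 / 2 * u + 1 / 2 * v) powr (1 / s)) powr s \<le> (a\<^sup>2 + b\<^sup>2) powr s"
    using s by (intro powr_mono2) auto
  then have "(u + v) / 2 \<le> (a\<^sup>2 + b\<^sup>2) powr s"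
    using s by (simp add: powr_powr u_def v_def)
  also have "\<dots> \<le> (a\<^sup>2) powr s + (b\<^sup>2) powr s" using s by (intro powr_add_le_of_le_1) auto
  finally show ?thesis by (simp add: u_def v_def sq)
qed

definition ell :: "real \<Rightarrow> (nat \<Rightarrow> real) set" where
  "ell q = {x. summable (\<lambda>k. \<bar>x k\<bar> powr q)}"

definition ell_norm :: "real \<Rightarrow> (nat \<Rightarrow> real) \<Rightarrow> real" where
  "ell_norm q x = (\<Sum>k. \<bar>x k\<bar> powr q) powr (1 / q)"

lemma ell_norm_nonneg: "0 \<le> ell_norm q x"
  by (simp add: ell_norm_def)

context
  fixes q :: real
  assumes q: "1 < q"
begin

lemma ell_norm_powr: "x \<in> ell q \<Longrightarrow> ell_norm q x powr q = (\<Sum>k. \<bar>x k\<bar> powr q)"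
  using q by (simp add: ell_norm_def ell_def powr_powr suminf_nonneg)

lemma sum_le_ell_norm: "x \<in> ell q \<Longrightarrow> (\<Sum>k<K. \<bar>x k\<bar> powr q) \<le> ell_norm q x powr q"
  unfolding ell_norm_powr by (intro sum_le_suminf) (auto simp: ell_def)

lemma ell_normI:
  assumes a: "0 \<le> a" and le: "\<And>K. (\<Sum>k<K. \<bar>x k\<bar> powr q) \<le> a powr q"
  shows "x \<in> ell q" "ell_norm q x \<le> a"
proof -
  show x: "x \<in> ell q" unfolding ell_def using le by (auto intro: summableI_nonneg_bounded[where x = "a powr q"])
  have "(\<Sum>k. \<bar>x k\<bar> powr q) \<le> a powr q"
    using x le by (intro suminf_le_const) (auto simp: ell_def)
  then have "ell_norm q x \<le> (a powr q) powr (1 / q)"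
    unfolding ell_norm_def using x q by (intro powr_mono2) (auto simp: ell_def suminf_nonneg)
  then show "ell_norm q x \<le> a" using a q by (simp add: powr_powr)
qed

lemma ell_norm_mono:
  assumes y: "y \<in> ell q" and le: "\<And>k. \<bar>x k\<bar> \<le> \<bar>y k\<bar>"
  shows "x \<in> ell q" "ell_norm q x \<le> ell_norm q y"
proof -
  have "(\<Sum>k<K. \<bar>x k\<bar> powr q) \<le> ell_norm q y powr q" for K
  proof -
    have "(\<Sum>k<K. \<bar>x k\<bar> powr q) \<le> (\<Sum>k<K. \<bar>y k\<bar> powr q)"
      using le q by (intro sum_mono powr_mono2) auto
    then show ?thesis using sum_le_ell_norm[OF y, of K] by simp
  qed
  then show "x \<in> ell q" "ell_norm q x \<le> ell_norm q y"
    using ell_normI[OF ell_norm_nonneg] by blast+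
qed

lemma abs_le_ell_norm:
  assumes "x \<in> ell q"
  shows "\<bar>x k\<bar> \<le> ell_norm q x"
proof -
  have "\<bar>x k\<bar> powr q \<le> (\<Sum>i<Suc k. \<bar>x i\<bar> powr q)"
    by (intro member_le_sum) auto
  also have "\<dots> \<le> ell_norm q x powr q" using assms by (rule sum_le_ell_norm)
  finally show ?thesis by (rule powr_le_powr_imp_le) (use q ell_norm_nonneg in auto)
qed

lemma ell_norm_scale:
  assumes "x \<in> ell q"
  shows "(\<lambda>k. c * x k) \<in> ell q" "ell_norm q (\<lambda>k. c * x k) = \<bar>c\<bar> * ell_norm q x"
proof -
  have eq: "\<bar>c * x k\<bar> powr q = \<bar>c\<bar> powr q * \<bar>x k\<bar> powr q" for k
    by (simp add: abs_mult powr_mult)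
  show "(\<lambda>k. c * x k) \<in> ell q" using assms by (simp add: ell_def eq summable_mult)
  have "(\<Sum>k. \<bar>c * x k\<bar> powr q) = \<bar>c\<bar> powr q * (\<Sum>k. \<bar>x k\<bar> powr q)"
    using assms by (simp add: ell_def eq suminf_mult)
  then show "ell_norm q (\<lambda>k. c * x k) = \<bar>c\<bar> * ell_norm q x"
    using assms q by (simp add: ell_norm_def ell_def powr_mult powr_powr suminf_nonneg)
qed

text \<open>
  Minkowski's inequality is convexity of the power \<open>q\<close> at the point \<open>x k / a\<close> and \<open>y k / b\<close> with
  weights \<open>a / (a + b)\<close> and \<open>b / (a + b)\<close>, where \<open>a\<close> and \<open>b\<close> are the two norms. Enlarging the norms
  by \<open>e\<close> avoids division by zero.
\<close>
lemma ell_norm_triangle: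
  assumes x: "x \<in> ell q" and y: "y \<in> ell q"
  shows "(\<lambda>k. x k + y k) \<in> ell q" "ell_norm q (\<lambda>k. x k + y k) \<le> ell_norm q x + ell_norm q y"
proof -
  have main: "(\<Sum>k<K. \<bar>x k + y k\<bar> powr q) \<le> (ell_norm q x + ell_norm q y + 2 * e) powr q"
    if e: "0 < e" for K e
  proof -
    define a b where "a = ell_norm q x + e" and "b = ell_norm q y + e"
    have ab: "0 < a" "0 < b" using e ell_norm_nonneg by (auto simp: a_def b_def add_nonneg_pos)
    have bd: "(\<Sum>k<K. (\<bar>z k\<bar> / c) powr q) \<le> 1"
      if z: "z \<in> ell q" and c: "ell_norm q z \<le> c" "0 < c" for z c
    proof -
      have "(\<Sum>k<K. (\<bar>z k\<bar> / c) powr q) = (\<Sum>k<K. \<bar>z k\<bar> powr q) / c powr q"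
        using c by (simp add: powr_divide sum_divide_distrib)
      also have "\<dots> \<le> ell_norm q z powr q / c powr q"
        using sum_le_ell_norm[OF z] by (intro divide_right_mono) auto
      also have "\<dots> \<le> c powr q / c powr q"
        using c q by (intro divide_right_mono powr_mono2 ell_norm_nonneg) auto
      finally show ?thesis using c by simp
    qed
    have pt: "\<bar>x k + y k\<bar> powr q \<le>
        (a + b) powr q * (a / (a + b) * (\<bar>x k\<bar> / a) powr q + b / (a + b) * (\<bar>y k\<bar> / b) powr q)" for k
    proof -
      have "\<bar>x k + y k\<bar> powr q \<le> ((a + b) * (a / (a + b) * (\<bar>x k\<bar> / a) + b / (a + b) * (\<bar>y k\<bar> / b))) powr q"
      proof (intro powr_mono2)
        have "(a + b) * (a / (a + b) * (\<bar>x k\<bar> / a) + b / (a + b) * (\<bar>y k\<bar> / b)) = \<bar>x k\<bar> + \<bar>y k\<bar>"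
          using ab by (simp add: distrib_left)
        then show "\<bar>x k + y k\<bar> \<le> (a + b) * (a / (a + b) * (\<bar>x k\<bar> / a) + b / (a + b) * (\<bar>y k\<bar> / b))"
          by simp
      qed (use q in auto)
      also have "\<dots> = (a + b) powr q * (a / (a + b) * (\<bar>x k\<bar> / a) + b / (a + b) * (\<bar>y k\<bar> / b)) powr q"
        using ab by (intro powr_mult)
      also have "\<dots> \<le> (a + b) powr q * (a / (a + b) * (\<bar>x k\<bar> / a) powr q + b / (a + b) * (\<bar>y k\<bar> / b) powr q)"
        using ab q by (intro mult_left_mono convex_powr_nonneg) (auto simp: add_divide_distrib[symmetric])
      finally show ?thesis .
    qed
    have "(\<Sum>k<K. \<bar>x k + y k\<bar> powr q) \<le> (\<Sum>k<K.
        (a + b) powr q * (a / (a + b) * (\<bar>x k\<bar> / a) powr q + b / (a + b) * (\<bar>y k\<bar> / b) powr q))"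
      by (intro sum_mono pt)
    also have "\<dots> = (a + b) powr q * (a / (a + b) * (\<Sum>k<K. (\<bar>x k\<bar> / a) powr q) +
        b / (a + b) * (\<Sum>k<K. (\<bar>y k\<bar> / b) powr q))"
      by (simp only: sum_distrib_left sum.distrib distrib_left)
    also have "\<dots> \<le> (a + b) powr q * (a / (a + b) * 1 + b / (a + b) * 1)"
      using ab e x y by (intro mult_left_mono add_mono bd) (auto simp: a_def b_def)
    also have "\<dots> = (a + b) powr q" using ab by (simp add: add_divide_distrib[symmetric])
    finally show ?thesis by (simp add: a_def b_def algebra_simps)
  qed
  show "(\<lambda>k. x k + y k) \<in> ell q"
    using ell_normI(1)[of "ell_norm q x + ell_norm q y + 2 * 1"] main[of 1]
    by (simp add: ell_norm_nonneg add_nonneg_nonneg)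
  show "ell_norm q (\<lambda>k. x k + y k) \<le> ell_norm q x + ell_norm q y"
  proof (rule field_le_epsilon)
    fix e :: real assume "0 < e"
    then show "ell_norm q (\<lambda>k. x k + y k) \<le> ell_norm q x + ell_norm q y + e"
      using main[of "e / 2"]
      by (intro ell_normI(2)) (auto simp: ell_norm_nonneg add_nonneg_nonneg)
  qed
qed

lemma ell_norm_diff:
  assumes "x \<in> ell q" "y \<in> ell q"
  shows "(\<lambda>k. x k - y k) \<in> ell q"
  using ell_norm_triangle(1)[OF assms(1) ell_norm_scale(1)[OF assms(2), of "-1"]] by simp

lemma ell_norm_eq_0:
  assumes "x \<in> ell q"
  shows "ell_norm q x = 0 \<longleftrightarrow> (\<forall>k. x k = 0)"
proof
  assume "ell_norm q x = 0"
  then show "\<forall>k. x k = 0" using abs_le_ell_norm[OF assms] by simp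
qed (simp add: ell_norm_def)

text \<open>
  The limit is taken coordinatewise. A bound on the norm of \<open>\<sigma> m - \<sigma> n\<close> is a bound on all finite
  partial sums, and in this form it survives the limit in \<open>n\<close>.
\<close>
lemma ell_complete:
  assumes \<sigma>: "\<And>n. \<sigma> n \<in> ell q"
    and cauchy: "\<And>e. 0 < e \<Longrightarrow> \<exists>M. \<forall>m\<ge>M. \<forall>n\<ge>M. ell_norm q (\<lambda>k. \<sigma> m k - \<sigma> n k) < e"
  shows "\<exists>x\<in>ell q. (\<lambda>n. ell_norm q (\<lambda>k. \<sigma> n k - x k)) \<longlonglongrightarrow> 0"
proof -
  have "Cauchy (\<lambda>n. \<sigma> n k)" for k
  proof (rule CauchyI)
    fix e :: real assume "0 < e"
    then obtain M where M: "\<And>m n. M \<le> m \<Longrightarrow> M \<le> n \<Longrightarrow> ell_norm q (\<lambda>k. \<sigma> m k - \<sigma> n k) < e"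
      using cauchy by blast
    have "norm (\<sigma> m k - \<sigma> n k) < e" if "M \<le> m" "M \<le> n" for m n
      using abs_le_ell_norm[OF ell_norm_diff[OF \<sigma>[of m] \<sigma>[of n]], of k] M[OF that] by simp
    then show "\<exists>M. \<forall>m\<ge>M. \<forall>n\<ge>M. norm (\<sigma> m k - \<sigma> n k) < e" by blast
  qed
  then have "\<exists>z. (\<lambda>n. \<sigma> n k) \<longlonglongrightarrow> z" for k
    by (simp add: Cauchy_convergent_iff convergent_def)
  then obtain x where x: "\<And>k. (\<lambda>n. \<sigma> n k) \<longlonglongrightarrow> x k" by metis
  have tail: "\<exists>M. \<forall>m\<ge>M. (\<lambda>k. \<sigma> m k - x k) \<in> ell q \<and> ell_norm q (\<lambda>k. \<sigma> m k - x k) \<le> e"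
    if e: "0 < e" for e
  proof -
    obtain M where M: "\<And>m n. M \<le> m \<Longrightarrow> M \<le> n \<Longrightarrow> ell_norm q (\<lambda>k. \<sigma> m k - \<sigma> n k) < e"
      using cauchy e by blast
    have "(\<Sum>k<K. \<bar>\<sigma> m k - x k\<bar> powr q) \<le> e powr q" if m: "M \<le> m" for m K
    proof (rule LIMSEQ_le_const2)
      show "(\<lambda>n. \<Sum>k<K. \<bar>\<sigma> m k - \<sigma> n k\<bar> powr q) \<longlonglongrightarrow> (\<Sum>k<K. \<bar>\<sigma> m k - x k\<bar> powr q)"
        using q by (intro tendsto_sum tendsto_powr' tendsto_rabs tendsto_diff tendsto_const x) auto
      have "(\<Sum>k<K. \<bar>\<sigma> m k - \<sigma> n k\<bar> powr q) \<le> e powr q" if "M \<le> n" for n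
      proof -
        have "(\<Sum>k<K. \<bar>\<sigma> m k - \<sigma> n k\<bar> powr q) \<le> ell_norm q (\<lambda>k. \<sigma> m k - \<sigma> n k) powr q"
          using ell_norm_diff[OF \<sigma> \<sigma>] by (rule sum_le_ell_norm)
        also have "\<dots> \<le> e powr q"
          using M[OF m that] q ell_norm_nonneg by (intro powr_mono2) auto
        finally show ?thesis .
      qed
      then show "\<exists>N. \<forall>n\<ge>N. (\<Sum>k<K. \<bar>\<sigma> m k - \<sigma> n k\<bar> powr q) \<le> e powr q" by blast
    qed
    then show ?thesis using ell_normI[of e] e by (metis less_imp_le)
  qed
  obtain m where "(\<lambda>k. \<sigma> m k - x k) \<in> ell q" using tail[of 1] by auto
  from ell_norm_diff[OF \<sigma>[of m] this] have "x \<in> ell q" by simp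
  moreover have "(\<lambda>n. ell_norm q (\<lambda>k. \<sigma> n k - x k)) \<longlonglongrightarrow> 0"
  proof (rule LIMSEQ_I)
    fix e :: real assume "0 < e"
    then obtain M where "\<forall>m\<ge>M. ell_norm q (\<lambda>k. \<sigma> m k - x k) \<le> e / 2"
      using tail[of "e / 2"] by auto
    then show "\<exists>M. \<forall>n\<ge>M. norm (ell_norm q (\<lambda>k. \<sigma> n k - x k) - 0) < e"
      using ell_norm_nonneg \<open>0 < e\<close> by (intro exI[of _ M]) (auto intro: le_less_trans)
  qed
  ultimately show ?thesis by blast
qed

lemma ell_tail_tendsto_0:
  assumes "x \<in> ell q"
  shows "(\<lambda>n. ell_norm q (\<lambda>k. if k < n then 0 else x k)) \<longlonglongrightarrow> 0"
proof -
  let ?y = "\<lambda>n k. if k < n then 0 else x k"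
  have sm: "summable (\<lambda>k. \<bar>x k\<bar> powr q)" using assms by (simp add: ell_def)
  have "(\<Sum>k. \<bar>?y n k\<bar> powr q) = (\<Sum>k. \<bar>x k\<bar> powr q) - (\<Sum>k<n. \<bar>x k\<bar> powr q)" for n
  proof -
    have "?y n \<in> ell q" using ell_norm_mono(1)[OF assms, of "?y n"] by auto
    then have "(\<Sum>k. \<bar>?y n k\<bar> powr q) = (\<Sum>k. \<bar>?y n (k + n)\<bar> powr q) + (\<Sum>k<n. \<bar>?y n k\<bar> powr q)"
      by (intro suminf_split_initial_segment) (simp add: ell_def)
    then show ?thesis using suminf_split_initial_segment[OF sm, of n] by simp
  qed
  moreover have "(\<lambda>n. (\<Sum>k. \<bar>x k\<bar> powr q) - (\<Sum>k<n. \<bar>x k\<bar> powr q)) \<longlonglongrightarrow>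
      (\<Sum>k. \<bar>x k\<bar> powr q) - (\<Sum>k. \<bar>x k\<bar> powr q)"
    by (intro tendsto_diff tendsto_const summable_LIMSEQ sm)
  ultimately have "(\<lambda>n. \<Sum>k. \<bar>?y n k\<bar> powr q) \<longlonglongrightarrow> 0" by simp
  then have "(\<lambda>n. (\<Sum>k. \<bar>?y n k\<bar> powr q) powr (1 / q)) \<longlonglongrightarrow> 0 powr (1 / q)"
    using q assms sm
    by (intro tendsto_powr') (auto intro!: always_eventually suminf_nonneg ell_norm_mono(1)[OF assms, unfolded ell_def, simplified])
  then show ?thesis by (simp add: ell_norm_def)
qed

text \<open>
  Summing \<open>powr_parallelogram_le\<close> over the coordinates bounds the mean of the \<open>q\<close>-th powers of the
  two norms by \<open>1 + u powr q\<close>; convexity passes to the \<open>q\<close>-th power of their mean.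
\<close>
lemma ell_smooth:
  assumes "q \<le> 2" and x: "x \<in> ell q" "ell_norm q x = 1" and y: "y \<in> ell q" "ell_norm q y = 1"
    and u: "0 \<le> u"
  shows "(ell_norm q (\<lambda>k. x k + u * y k) + ell_norm q (\<lambda>k. x k - u * y k)) / 2 - 1 \<le> u powr q"
proof -
  let ?a = "\<lambda>k. x k + u * y k" and ?b = "\<lambda>k. x k - u * y k"
  define A B where "A = ell_norm q ?a" and "B = ell_norm q ?b"
  have uy: "(\<lambda>k. u * y k) \<in> ell q" "ell_norm q (\<lambda>k. u * y k) = u"
    using ell_norm_scale[OF y(1), of u] y(2) u by auto
  have ab: "?a \<in> ell q" "?b \<in> ell q"
    using ell_norm_triangle(1)[OF x(1) uy(1)] ell_norm_diff[OF x(1) uy(1)] by auto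
  have "A powr q + B powr q = (\<Sum>k. \<bar>?a k\<bar> powr q + \<bar>?b k\<bar> powr q)"
    unfolding A_def B_def ell_norm_powr[OF ab(1)] ell_norm_powr[OF ab(2)]
    using ab by (intro suminf_add) (auto simp: ell_def)
  also have "\<dots> \<le> (\<Sum>k. 2 * (\<bar>x k\<bar> powr q + \<bar>u * y k\<bar> powr q))"
    using ab x uy q assms(1)
    by (intro suminf_le powr_parallelogram_le summable_add summable_mult) (auto simp: ell_def)
  also have "\<dots> = 2 * (\<Sum>k. \<bar>x k\<bar> powr q + \<bar>u * y k\<bar> powr q)"
    using x uy by (intro suminf_mult summable_add) (auto simp: ell_def)
  also have "\<dots> = 2 * (ell_norm q x powr q + ell_norm q (\<lambda>k. u * y k) powr q)"
    unfolding ell_norm_powr[OF x(1)] ell_norm_powr[OF uy(1)] using x uy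
    by (subst suminf_add) (auto simp: ell_def)
  finally have AB: "A powr q + B powr q \<le> 2 * (1 + u powr q)" using x uy by simp
  have "(1 / 2 * A + 1 / 2 * B) powr q \<le> 1 / 2 * A powr q + 1 / 2 * B powr q"
    using q by (intro convex_powr_nonneg) (auto simp: A_def B_def ell_norm_nonneg)
  also have "\<dots> \<le> (1 + u powr q) powr 1" using AB by simp
  also have "\<dots> \<le> (1 + u powr q) powr q" using q by (intro powr_mono) auto
  finally have "1 / 2 * A + 1 / 2 * B \<le> 1 + u powr q"
    by (rule powr_le_powr_imp_le) (use q in auto)
  then show ?thesis by (simp add: A_def B_def add_divide_distrib)
qed

text \<open>
  Hoelder's inequality in the normalized form in which Young's inequality gives it termwise.
\<close>
lemma ell_dual_pairing:
  assumes p: "p = q / (q - 1)" and x: "x \<in> ell q" "ell_norm q x \<le> 1"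
    and w: "summable (\<lambda>k. \<bar>w k\<bar> powr p)" "(\<Sum>k. \<bar>w k\<bar> powr p) \<le> 1"
  shows "summable (\<lambda>k. w k * x k)" "\<bar>\<Sum>k. w k * x k\<bar> \<le> 1"
proof -
  have p1: "1 < p" "1 / q + 1 / p = 1" using q by (auto simp: p field_simps)
  let ?g = "\<lambda>k. \<bar>x k\<bar> powr q / q + \<bar>w k\<bar> powr p / p"
  have pt: "norm (w k * x k) \<le> ?g k" for k
    using Youngs_inequality[OF q p1, of "\<bar>x k\<bar>" "\<bar>w k\<bar>"] by (simp add: abs_mult mult.commute)
  have g: "summable ?g" using x w by (intro summable_add summable_divide) (auto simp: ell_def)
  have abs: "summable (\<lambda>k. norm (w k * x k))"
    using pt by (intro summable_comparison_test[OF _ g]) auto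
  then show "summable (\<lambda>k. w k * x k)" by (rule summable_norm_cancel)
  have "\<bar>\<Sum>k. w k * x k\<bar> \<le> (\<Sum>k. norm (w k * x k))" using summable_norm[OF abs] by simp
  also have "\<dots> \<le> suminf ?g" by (rule suminf_le[OF pt abs g])
  also have "\<dots> = (\<Sum>k. \<bar>x k\<bar> powr q) / q + (\<Sum>k. \<bar>w k\<bar> powr p) / p"
    using x w by (subst suminf_add[symmetric]) (auto simp: ell_def suminf_divide summable_divide)
  also have "\<dots> \<le> 1 / q + 1 / p"
  proof (intro add_mono divide_right_mono w)
    show "(\<Sum>k. \<bar>x k\<bar> powr q) \<le> 1"
      using x(2) ell_norm_powr[OF x(1)] q ell_norm_nonneg powr_mono2[of q "ell_norm q x" 1] by simp
  qed (use q p1 in auto)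
  finally show "\<bar>\<Sum>k. w k * x k\<bar> \<le> 1" using p1 by simp
qed

end

section \<open>The sequence space inside the universe\<close>

abbreviation coord :: "'a::real_vector universe \<Rightarrow> nat \<Rightarrow> real" where
  "coord z \<equiv> apply_bcontfun (snd z)"

text \<open>Meaningful for bounded sequences, on which \<open>Bcontfun\<close> inverts \<open>apply_bcontfun\<close>.\<close>
definition embed :: "(nat \<Rightarrow> real) \<Rightarrow> 'a::real_vector universe" where
  "embed x = (0, Bcontfun x)"

definition ell_space :: "real \<Rightarrow> 'a::real_vector universe set" where
  "ell_space q = {z. fst z = 0 \<and> coord z \<in> ell q}"

definition ell_space_norm :: "real \<Rightarrow> 'a::real_vector universe \<Rightarrow> real" where
  "ell_space_norm q z = ell_norm q (coord z)"

definition unit_vector :: "nat \<Rightarrow> 'a::real_vector universe" where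
  "unit_vector k = embed (\<lambda>i. of_bool (i = k))"

definition unit_dictionary :: "'a::real_vector universe set" where
  "unit_dictionary = range unit_vector \<union> uminus ` range unit_vector"

lemma coord_embed:
  assumes "1 < q" "x \<in> ell q"
  shows "coord (embed x :: 'a::real_vector universe) = x"
proof -
  have "x \<in> bcontfun"
    using abs_le_ell_norm[OF assms] by (intro bcontfun_normI[of _ "ell_norm q x"]) auto
  then show ?thesis by (simp add: embed_def Bcontfun_inverse)
qed

lemma embed_in_ell_space: "1 < q \<Longrightarrow> x \<in> ell q \<Longrightarrow> embed x \<in> ell_space q"
  by (simp add: ell_space_def coord_embed) (simp add: embed_def)

lemma finite_support_in_ell: "finite {k. x k \<noteq> 0} \<Longrightarrow> x \<in> ell q"
  unfolding ell_def mem_Collect_eq by (rule summable_finite) auto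

lemma coord_unit_vector: "coord (unit_vector k) i = of_bool (i = k)"
proof -
  have "(\<lambda>i. of_bool (i = k)) \<in> ell 2" by (rule finite_support_in_ell) simp
  then show ?thesis by (simp add: unit_vector_def coord_embed[of 2])
qed

lemma fst_unit_vector: "fst (unit_vector k) = 0"
  by (simp add: unit_vector_def embed_def)

lemma unit_vector_in_ell_space: "unit_vector k \<in> ell_space q"
  by (auto simp: ell_space_def fst_unit_vector coord_unit_vector intro: finite_support_in_ell)

lemma coord_sum: "coord (\<Sum>k\<in>K. c k *\<^sub>R unit_vector k) i = (\<Sum>k\<in>K. c k * of_bool (i = k))"
  by (induction K rule: infinite_finite_induct) (auto simp: coord_unit_vector)

lemma coord_combination:
  "finite K \<Longrightarrow> coord (\<Sum>k\<in>K. c k *\<^sub>R unit_vector k) i = (if i \<in> K then c i else 0)"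
  by (simp add: coord_sum of_bool_def if_distrib cong: if_cong)

lemma ell_space_norm_unit_vector:
  assumes "1 < q"
  shows "ell_space_norm q (unit_vector k :: 'a::real_vector universe) = 1"
proof -
  have "\<bar>coord (unit_vector k :: 'a universe) i\<bar> powr q = (if i = k then 1 else 0)" for i
    by (simp add: coord_unit_vector)
  then show ?thesis
    by (simp add: ell_space_norm_def ell_norm_def sums_unique[OF sums_single, symmetric])
qed

lemma banach_ell_space:
  assumes q: "1 < q"
  shows "banach_space_on (ell_space q :: 'a::real_vector universe set) (ell_space_norm q)"
proof -
  have "subspace (ell_space q :: 'a universe set)"
    using ell_norm_triangle(1)[OF q] ell_norm_scale(1)[OF q]
    by (auto simp: subspace_def ell_space_def plus_bcontfun.rep_eq intro: finite_support_in_ell)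
  moreover have "norm_on (ell_space q :: 'a universe set) (ell_space_norm q)"
    unfolding norm_on_def
  proof (intro conjI ballI allI)
    fix x :: "'a universe"
    assume x: "x \<in> ell_space q"
    show "0 \<le> ell_space_norm q x" by (simp add: ell_space_norm_def ell_norm_nonneg)
    have "(\<forall>k. coord x k = 0) \<longleftrightarrow> snd x = 0" by (metis bcontfun_eqI zero_bcontfun.rep_eq)
    then show "ell_space_norm q x = 0 \<longleftrightarrow> x = 0"
      using x ell_norm_eq_0[OF q, of "coord x"]
      by (simp add: ell_space_def ell_space_norm_def prod_eq_iff)
    show "ell_space_norm q (c *\<^sub>R x) = \<bar>c\<bar> * ell_space_norm q x" for c
      using x ell_norm_scale(2)[OF q, of "coord x" c] by (simp add: ell_space_def ell_space_norm_def)
    show "ell_space_norm q (x + y) \<le> ell_space_norm q x + ell_space_norm q y"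
      if "y \<in> ell_space q" for y
      using x that ell_norm_triangle(2)[OF q, of "coord x" "coord y"]
      by (simp add: ell_space_def ell_space_norm_def)
  qed
  moreover have "complete_on (ell_space q :: 'a universe set) (ell_space_norm q)"
    unfolding complete_on_def
  proof (intro allI impI, elim conjE)
    fix \<sigma> :: "nat \<Rightarrow> 'a universe"
    assume \<sigma>: "\<forall>n. \<sigma> n \<in> ell_space q"
      and cauchy: "\<forall>\<epsilon>>0. \<exists>M. \<forall>m\<ge>M. \<forall>n\<ge>M. ell_space_norm q (\<sigma> m - \<sigma> n) < \<epsilon>"
    have "\<exists>x\<in>ell q. (\<lambda>n. ell_norm q (\<lambda>k. coord (\<sigma> n) k - x k)) \<longlonglongrightarrow> 0"
      using \<sigma> cauchy
      by (intro ell_complete[OF q]) (auto simp: ell_space_def ell_space_norm_def)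
    then obtain x where x: "x \<in> ell q" "(\<lambda>n. ell_norm q (\<lambda>k. coord (\<sigma> n) k - x k)) \<longlonglongrightarrow> 0"
      by blast
    then show "\<exists>x\<in>ell_space q. (\<lambda>n. ell_space_norm q (\<sigma> n - x)) \<longlonglongrightarrow> 0"
      using embed_in_ell_space[OF q x(1)] coord_embed[OF q x(1), where 'a = 'a]
      by (intro bexI[of _ "embed x"]) (simp_all add: ell_space_norm_def)
  qed
  ultimately show ?thesis by (simp add: banach_space_on_def)
qed

lemma smooth_class_ell_space:
  assumes q: "1 < q" "q \<le> 2"
  shows "smooth_class q (ell_space q :: 'a::real_vector universe set) (ell_space_norm q)"
proof -
  define A where "A = {x \<in> ell_space q :: 'a universe set. ell_space_norm q x = 1}"
  have "modulus_of_smoothness (ell_space q :: 'a universe set) (ell_space_norm q) u \<le> 1 * u powr q"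
    if u: "0 \<le> u" for u
    unfolding modulus_of_smoothness_def A_def[symmetric]
  proof (rule cSUP_least)
    have "unit_vector 0 \<in> A"
      by (simp add: A_def unit_vector_in_ell_space ell_space_norm_unit_vector[OF q(1)])
    then show "A \<times> A \<noteq> {}" by auto
  next
    fix z
    assume "z \<in> A \<times> A"
    then obtain x y where z: "z = (x, y)" and x: "x \<in> A" and y: "y \<in> A" by (rule SigmaE)
    show "(case z of (x, y) \<Rightarrow>
        (ell_space_norm q (x + u *\<^sub>R y) + ell_space_norm q (x - u *\<^sub>R y)) / 2 - 1) \<le> 1 * u powr q"
      using ell_smooth[OF q, of "coord x" "coord y" u] x y u
      by (simp add: z A_def ell_space_def ell_space_norm_def)
  qed
  then show ?thesis using banach_ell_space[OF q(1)] unfolding smooth_class_def by (meson zero_less_one)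
qed

lemma dictionary_unit_vectors:
  assumes q: "1 < q"
  shows "dictionary (ell_space q) (ell_space_norm q) (unit_dictionary :: 'a::real_vector universe set)"
proof -
  interpret normed_subspace "ell_space q :: 'a universe set" "ell_space_norm q"
    using banach_ell_space[OF q] by unfold_locales (auto simp: banach_space_on_def)
  have D: "unit_dictionary \<subseteq> (ell_space q :: 'a universe set)"
    using unit_vector_in_ell_space subspace_neg[OF subspace unit_vector_in_ell_space]
    unfolding unit_dictionary_def by blast
  have "\<exists>y\<in>span unit_dictionary. ell_space_norm q (z - y) < e"
    if z: "z \<in> ell_space q" and e: "0 < e" for z :: "'a universe" and e
  proof -
    define y where "y n = (\<Sum>k<n. coord z k *\<^sub>R unit_vector k :: 'a universe)" for n
    have "y n \<in> span unit_dictionary" for n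
      unfolding y_def by (intro span_sum span_scale span_base) (auto simp: unit_dictionary_def)
    moreover have "coord (z - y n) = (\<lambda>k. if k < n then 0 else coord z k)" for n
      by (auto simp: y_def coord_combination)
    moreover obtain n where "ell_norm q (\<lambda>k. if k < n then 0 else coord z k) < e"
      using order_tendstoD(2)[OF ell_tail_tendsto_0[OF q] e] z
      by (auto simp: ell_space_def eventually_sequentially)
    ultimately show ?thesis by (metis ell_space_norm_def)
  qed
  then have "closure_on (ell_space q) (ell_space_norm q) (span unit_dictionary) =
      (ell_space q :: 'a universe set)"
    unfolding closure_on_def by blast
  moreover have "ell_space_norm q g = 1 \<and> - g \<in> unit_dictionary"
    if "g \<in> unit_dictionary" for g :: "'a universe"
  proof -
    from that obtain k where "g = unit_vector k \<or> g = - unit_vector k"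
      unfolding unit_dictionary_def by blast
    then show ?thesis
      using ell_space_norm_unit_vector[OF q] norm_minus[OF unit_vector_in_ell_space]
      unfolding unit_dictionary_def by (metis UnI1 UnI2 imageI minus_minus rangeI)
  qed
  ultimately show ?thesis using D unfolding dictionary_def by blast
qed

section \<open>Norming functionals\<close>

lemma pairing_functional:
  assumes q: "1 < q" and p: "p = q / (q - 1)"
    and w: "summable (\<lambda>k. \<bar>w k\<bar> powr p)" "(\<Sum>k. \<bar>w k\<bar> powr p) \<le> 1"
  defines "F \<equiv> \<lambda>z :: 'a::real_vector universe. \<Sum>k. w k * coord z k"
  shows "bounded_functional_on (ell_space q) (ell_space_norm q) F"
    and "dual_norm_on (ell_space q) (ell_space_norm q) F \<le> 1"
proof -
  have pair: "summable (\<lambda>k. w k * x k) \<and> \<bar>\<Sum>k. w k * x k\<bar> \<le> ell_norm q x" if x: "x \<in> ell q" for x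
  proof (cases "ell_norm q x = 0")
    case True
    then show ?thesis using ell_norm_eq_0[OF q x] by simp
  next
    case False
    define c where "c = ell_norm q x"
    have c: "0 < c" using False ell_norm_nonneg[of q x] by (simp add: c_def)
    let ?y = "\<lambda>k. 1 / c * x k"
    have y: "?y \<in> ell q" "ell_norm q ?y \<le> 1"
      using ell_norm_scale[OF q x, of "1 / c"] c by (auto simp: c_def)
    note d = ell_dual_pairing[OF q p y w]
    have eq: "w k * x k = c * (w k * ?y k)" for k using c by simp
    have "summable (\<lambda>k. w k * x k)" unfolding eq by (intro summable_mult d)
    moreover have "(\<Sum>k. w k * x k) = c * (\<Sum>k. w k * ?y k)"
      unfolding eq by (intro suminf_mult d)
    ultimately show ?thesis using d(2) c by (simp add: abs_mult c_def[symmetric])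
  qed
  have F_le: "\<bar>F z\<bar> \<le> 1 * ell_space_norm q z" if "z \<in> ell_space q" for z
    using pair[of "coord z"] that by (simp add: F_def ell_space_def ell_space_norm_def)
  have "F (y + z) = F y + F z" if "y \<in> ell_space q" "z \<in> ell_space q" for y z
    using pair[of "coord y"] pair[of "coord z"] that
    by (simp add: F_def ell_space_def distrib_left suminf_add)
  moreover have "F (c *\<^sub>R z) = c * F z" if "z \<in> ell_space q" for c z
    using pair[of "coord z"] that suminf_mult[of "\<lambda>k. w k * coord z k" c]
    by (simp add: F_def ell_space_def mult.left_commute)
  ultimately show "bounded_functional_on (ell_space q) (ell_space_norm q) F"
    using F_le unfolding bounded_functional_on_def by blast
  have "(0 :: 'a universe) \<in> ell_space q \<and> ell_space_norm q (0 :: 'a universe) \<le> 1"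
    by (auto simp: ell_space_def ell_space_norm_def ell_norm_def intro: finite_support_in_ell)
  then have "{z :: 'a universe. z \<in> ell_space q \<and> ell_space_norm q z \<le> 1} \<noteq> {}" by blast
  then show "dual_norm_on (ell_space q) (ell_space_norm q) F \<le> 1"
    unfolding dual_norm_on_def using F_le by (intro cSUP_least) fastforce+
qed

text \<open>
  The derivative of the norm at a nonzero sequence \<open>x\<close> with nonnegative entries; for such \<open>x\<close>, signs
  need not be attached to the powers. Its coefficients have \<open>p\<close>-norm 1 for the
  conjugate exponent \<open>p = q / (q - 1)\<close>, because \<open>(q - 1) * p = q\<close>.
\<close>
definition norming_functional :: "real \<Rightarrow> (nat \<Rightarrow> real) \<Rightarrow> 'a::real_vector universe \<Rightarrow> real" where
  "norming_functional q x z = (\<Sum>k. (x k / ell_norm q x) powr (q - 1) * coord z k)"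

lemma norming_functional:
  assumes q: "1 < q" and x: "x \<in> ell q" "\<And>k. 0 \<le> x k" "ell_norm q x \<noteq> 0"
  shows "bounded_functional_on (ell_space q) (ell_space_norm q)
           (norming_functional q x :: 'a::real_vector universe \<Rightarrow> real)"
    and "dual_norm_on (ell_space q) (ell_space_norm q)
           (norming_functional q x :: 'a universe \<Rightarrow> real) \<le> 1"
    and "coord (z :: 'a universe) = x \<Longrightarrow> norming_functional q x z = ell_norm q x"
proof -
  define c where "c = ell_norm q x"
  have c: "0 < c" using x(3) ell_norm_nonneg[of q x] by (simp add: c_def)
  have wq: "\<bar>(x k / c) powr (q - 1)\<bar> powr (q / (q - 1)) = \<bar>x k\<bar> powr q / c powr q" for k
    using x(2)[of k] q c by (simp add: powr_powr powr_divide)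
  have sm: "summable (\<lambda>k. \<bar>x k\<bar> powr q)" and cq: "c powr q = (\<Sum>k. \<bar>x k\<bar> powr q)"
    using x(1) ell_norm_powr[OF q x(1)] by (auto simp: ell_def c_def)
  have w: "summable (\<lambda>k. \<bar>(x k / c) powr (q - 1)\<bar> powr (q / (q - 1)))"
    "(\<Sum>k. \<bar>(x k / c) powr (q - 1)\<bar> powr (q / (q - 1))) \<le> 1"
    unfolding wq using sm cq c by (auto simp: suminf_divide intro: summable_divide)
  have F: "norming_functional q x = (\<lambda>z :: 'a universe. \<Sum>k. (x k / c) powr (q - 1) * coord z k)"
    by (simp add: norming_functional_def c_def fun_eq_iff)
  show "bounded_functional_on (ell_space q) (ell_space_norm q)
           (norming_functional q x :: 'a universe \<Rightarrow> real)"
    and "dual_norm_on (ell_space q) (ell_space_norm q)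
           (norming_functional q x :: 'a universe \<Rightarrow> real) \<le> 1"
    unfolding F using pairing_functional[OF q refl w] by auto
  assume z: "coord z = x"
  have "(x k / c) powr (q - 1) * x k = c * (\<bar>x k\<bar> powr q / c powr q)" for k
  proof -
    have "(x k / c) powr (q - 1) * (x k / c) powr 1 = (x k / c) powr q"
      unfolding powr_add[symmetric] by simp
    then show ?thesis using x(2)[of k] c by (simp add: powr_divide field_simps)
  qed
  then have "norming_functional q x z = c * (c powr q / c powr q)"
    unfolding norming_functional_def z c_def[symmetric] cq
    using sm by (simp add: suminf_mult suminf_divide summable_divide)
  then show "norming_functional q x z = ell_norm q x" using c by (simp add: c_def)
qed

lemma norming_functional_unit_vector:
  "norming_functional q x (unit_vector k :: 'a::real_vector universe) =
     (x k / ell_norm q x) powr (q - 1)"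
proof -
  have "(x i / ell_norm q x) powr (q - 1) * coord (unit_vector k :: 'a universe) i =
      (if i = k then (x i / ell_norm q x) powr (q - 1) else 0)" for i
    by (simp add: coord_unit_vector)
  then show ?thesis
    by (simp add: norming_functional_def sums_unique[OF sums_single, symmetric])
qed

section \<open>A divergent realization\<close>

text \<open>
  The coefficients are chosen so that their powers with exponent \<open>q - 1\<close>, which up to scaling are
  the values of the norming functionals at the unit vectors, are 1 at index 0 and \<open>t k\<close> at index
  \<open>k \<ge> 1\<close>.
\<close>
definition witness :: "real \<Rightarrow> (nat \<Rightarrow> real) \<Rightarrow> nat \<Rightarrow> real" where
  "witness q t k = (if k = 0 then 1 else t k powr (1 / (q - 1)))"

definition witness_residual :: "real \<Rightarrow> (nat \<Rightarrow> real) \<Rightarrow> nat \<Rightarrow> nat \<Rightarrow> real" where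
  "witness_residual q t n k = (if k \<in> {1..n} then 0 else witness q t k)"

text \<open>
  The unit vector with index 0 always attains the supremum of the norming functional, yet the unit
  vector with index \<open>n\<close> is admissible at step \<open>n\<close>, since its value is \<open>t n\<close> times that supremum. A
  realization may therefore pass over the index 0 forever.
\<close>
theorem awcga_diverges_if_summable:
  fixes q :: real and t \<delta> \<eta> :: "nat \<Rightarrow> real"
  assumes q: "1 < q" and t: "weakness_sequence t"
    and \<delta>: "perturbation_sequence \<delta>" and \<eta>: "error_sequence \<eta>"
    and sm: "summable (\<lambda>n. t (Suc n) powr (q / (q - 1)))"
  shows "\<exists>f\<in>ell_space q. \<not> awcga_converges t \<delta> \<eta>
           (ell_space q :: 'a::real_vector universe set) (ell_space_norm q) unit_dictionary f"
proof -
  interpret normed_subspace "ell_space q :: 'a universe set" "ell_space_norm q"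
    using banach_ell_space[OF q] by unfold_locales (auto simp: banach_space_on_def)
  let ?res = "witness_residual q t" and ?u = "unit_vector :: nat \<Rightarrow> 'a universe"
  have t01: "0 \<le> t n" "t n \<le> 1" if "1 \<le> n" for n
    using t that by (auto simp: weakness_sequence_def)
  have nn: "0 \<le> ?res n k" for n k by (simp add: witness_residual_def witness_def)
  have "summable (\<lambda>k. \<bar>witness q t (Suc k)\<bar> powr q)"
    using sm q by (simp add: witness_def powr_powr)
  then have c: "witness q t \<in> ell q"
    by (simp add: ell_def summable_Suc_iff[of "\<lambda>k. \<bar>witness q t k\<bar> powr q"])
  have res: "?res n \<in> ell q" for n
    using ell_norm_mono(1)[OF q c] by (simp add: witness_residual_def)
  have res_ge: "1 \<le> ell_norm q (?res n)" for n
    using abs_le_ell_norm[OF q res[of n], of 0] by (simp add: witness_residual_def witness_def)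
  define f where "f = (embed (witness q t) :: 'a universe)"
  define G where "G n = (\<Sum>k\<in>{1..n}. witness q t k *\<^sub>R ?u k)" for n
  define r where "r n = f - G n" for n
  define F where "F n = (norming_functional q (?res n) :: 'a universe \<Rightarrow> real)" for n
  have f: "f \<in> ell_space q" "coord f = witness q t"
    using embed_in_ell_space[OF q c] coord_embed[OF q c] by (auto simp: f_def)
  have r: "coord (r n) = ?res n" for n
    by (auto simp: r_def f G_def coord_combination witness_residual_def)
  have N_r: "ell_space_norm q (r n) = ell_norm q (?res n)" for n
    by (simp add: ell_space_norm_def r)
  have "ell_norm q (?res n) \<noteq> 0" for n using res_ge[of n] by simp
  note F = norming_functional[where 'a = 'a, OF q res nn this, folded F_def]
  have F_unit: "F n (?u k) = ?res n k powr (q - 1) / ell_norm q (?res n) powr (q - 1)" for n k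
    unfolding F_def norming_functional_unit_vector using nn ell_norm_nonneg by (intro powr_divide)
  have sup: "(SUP g\<in>unit_dictionary. F n g) \<le> 1 / ell_norm q (?res n) powr (q - 1)" for n
  proof (rule cSUP_least)
    fix g :: "'a universe"
    assume "g \<in> unit_dictionary"
    then obtain k where "g = ?u k \<or> g = - ?u k" unfolding unit_dictionary_def by blast
    moreover have "F n (- ?u k) = - F n (?u k)"
      using F(1)[of n] unit_vector_in_ell_space[of k] scaleR_minus1_left[of "?u k"]
      unfolding bounded_functional_on_def by (metis mult_minus1)
    moreover have "0 \<le> F n (?u k)" by (simp add: F_unit)
    moreover have "?res n k powr (q - 1) \<le> 1"
      using q t01[of k] by (auto simp: witness_residual_def witness_def powr_powr)
    then have "F n (?u k) \<le> 1 / ell_norm q (?res n) powr (q - 1)"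
      unfolding F_unit by (intro divide_right_mono) auto
    ultimately show "F n g \<le> 1 / ell_norm q (?res n) powr (q - 1)" by auto
  qed (simp add: unit_dictionary_def)
  have best: "ell_space_norm q (r n) \<le> ell_space_norm q (f - g)" if "g \<in> span (?u ` {1..n})" for n g
  proof -
    have g: "g \<in> ell_space q"
      using that span_minimal[OF _ subspace, of "?u ` {1..n}"] unit_vector_in_ell_space by blast
    have g0: "coord g k = 0" if k: "k \<notin> {1..n}" for k
      using \<open>g \<in> span (?u ` {1..n})\<close>
      by (induction rule: span_induct_alt) (use k in \<open>auto simp: coord_unit_vector\<close>)
    have "\<bar>?res n k\<bar> \<le> \<bar>coord (f - g) k\<bar>" for k
      using g0[of k] by (auto simp: witness_residual_def f)
    moreover have "coord (f - g) \<in> ell q"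
      using subspace_diff[OF subspace f(1) g] by (simp add: ell_space_def)
    ultimately show ?thesis
      unfolding N_r unfolding ell_space_norm_def by (intro ell_norm_mono(2)[OF q])
  qed
  have "awcga_realization t \<delta> \<eta> (ell_space q) (ell_space_norm q) unit_dictionary f F ?u G r"
    unfolding awcga_realization_def
  proof (intro conjI allI impI)
    show "r 0 = f" by (simp add: r_def G_def)
    fix n :: nat
    assume n: "1 \<le> n"
    show "bounded_functional_on (ell_space q) (ell_space_norm q) (F (n - 1))"
      and "dual_norm_on (ell_space q) (ell_space_norm q) (F (n - 1)) \<le> 1"
      by (rule F)+
    have "F (n - 1) (r (n - 1)) = ell_space_norm q (r (n - 1))" unfolding N_r by (rule F(3)[OF r])
    moreover have "(1 - \<delta> (n - 1)) * ell_space_norm q (r (n - 1)) \<le> 1 * ell_space_norm q (r (n - 1))"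
      using \<delta> by (intro mult_right_mono) (auto simp: perturbation_sequence_def N_r ell_norm_nonneg)
    ultimately show "(1 - \<delta> (n - 1)) * ell_space_norm q (r (n - 1)) \<le> F (n - 1) (r (n - 1))" by simp
    show "?u n \<in> unit_dictionary" by (simp add: unit_dictionary_def)
    have "F (n - 1) (?u n) = t n * (1 / ell_norm q (?res (n - 1)) powr (q - 1))"
      using n q t01[OF n] by (simp add: F_unit witness_residual_def witness_def powr_powr)
    then show "t n * (SUP g\<in>unit_dictionary. F (n - 1) g) \<le> F (n - 1) (?u n)"
      using mult_left_mono[OF sup t01(1)[OF n], of "n - 1"] by simp
    show "G n \<in> span (?u ` {1..n})"
      unfolding G_def by (intro span_sum span_scale span_base) auto
    have "ell_space_norm q (f - G n) \<le> (INF g\<in>span (?u ` {1..n}). ell_space_norm q (f - g))"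
      unfolding r_def[symmetric] using best span_zero by (intro cINF_greatest) blast+
    moreover have "0 \<le> ell_space_norm q (f - G n)" by (simp add: ell_space_norm_def ell_norm_nonneg)
    moreover have "0 \<le> \<eta> n" using \<eta> n by (simp add: error_sequence_def)
    ultimately show "ell_space_norm q (f - G n) \<le>
        (1 + \<eta> n) * (INF g\<in>span (?u ` {1..n}). ell_space_norm q (f - g))"
      by (smt (verit) mult_right_mono mult_cancel_right1)
    show "r n = f - G n" by (rule r_def)
  qed
  moreover have "\<not> (\<lambda>n. ell_space_norm q (r n)) \<longlonglongrightarrow> 0"
  proof
    assume "(\<lambda>n. ell_space_norm q (r n)) \<longlonglongrightarrow> 0"
    then have "1 \<le> (0 :: real)" using res_ge by (intro LIMSEQ_le_const) (auto simp: N_r)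
    then show False by simp
  qed
  ultimately show ?thesis using f(1) unfolding awcga_converges_def by blast
qed

section \<open>The characterization\<close>

lemma sum_at_top_iff_not_summable:
  fixes a :: "nat \<Rightarrow> real"
  assumes nn: "\<And>n. 0 \<le> a n"
  shows "filterlim (\<lambda>m. \<Sum>n=1..m. a n) at_top sequentially \<longleftrightarrow> \<not> summable (\<lambda>n. a (Suc n))"
proof -
  have eq: "(\<Sum>n=1..m. a n) = (\<Sum>n<m. a (Suc n))" for m
    by (simp add: sum.atLeast1_atMost_eq)
  show ?thesis
  proof
    assume lim: "filterlim (\<lambda>m. \<Sum>n=1..m. a n) at_top sequentially"
    show "\<not> summable (\<lambda>n. a (Suc n))"
    proof
      assume sm: "summable (\<lambda>n. a (Suc n))"
      have "\<forall>\<^sub>F m in sequentially. suminf (\<lambda>n. a (Suc n)) < (\<Sum>n=1..m. a n)"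
        using lim by (simp add: filterlim_at_top_dense)
      then obtain m where "suminf (\<lambda>n. a (Suc n)) < (\<Sum>n<m. a (Suc n))"
        unfolding eq eventually_sequentially by blast
      moreover have "(\<Sum>n<m. a (Suc n)) \<le> suminf (\<lambda>n. a (Suc n))"
        using nn by (intro sum_le_suminf[OF sm]) auto
      ultimately show False by simp
    qed
  next
    assume ns: "\<not> summable (\<lambda>n. a (Suc n))"
    show "filterlim (\<lambda>m. \<Sum>n=1..m. a n) at_top sequentially"
      unfolding filterlim_at_top
    proof
      fix Z :: real
      obtain m where m: "Z < (\<Sum>n<m. a (Suc n))"
        using summableI_nonneg_bounded[of "\<lambda>n. a (Suc n)" Z] nn ns by (meson not_le)
      have "Z \<le> (\<Sum>n<k. a (Suc n))" if "m \<le> k" for k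
        using m sum_mono2[of "{..<k}" "{..<m}" "\<lambda>n. a (Suc n)"] nn that by force
      then show "\<forall>\<^sub>F m in sequentially. Z \<le> (\<Sum>n=1..m. a n)"
        unfolding eq eventually_sequentially by blast
    qed
  qed
qed

theorem theorem3:
  fixes q p :: real and t \<delta> \<eta> :: "nat \<Rightarrow> real"
  assumes "1 < q" and "q \<le> 2" and "p = q / (q - 1)"
    and "weakness_sequence t"
    and "perturbation_sequence \<delta>" and "summable \<delta>"
    and "error_sequence \<eta>" and "summable (\<lambda>n. \<eta> (Suc n))"
  shows "(\<forall>(S :: ('a::real_vector) universe set) N D f.
            smooth_class q S N \<longrightarrow> dictionary S N D \<longrightarrow> f \<in> S \<longrightarrow> awcga_converges t \<delta> \<eta> S N D f)
         \<longleftrightarrow> filterlim (\<lambda>m. \<Sum>n=1..m. t n powr p) at_top sequentially"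
  unfolding sum_at_top_iff_not_summable[OF powr_ge_zero]
proof
  assume conv: "\<forall>(S :: 'a universe set) N D f.
    smooth_class q S N \<longrightarrow> dictionary S N D \<longrightarrow> f \<in> S \<longrightarrow> awcga_converges t \<delta> \<eta> S N D f"
  show "\<not> summable (\<lambda>n. t (Suc n) powr p)"
  proof
    assume "summable (\<lambda>n. t (Suc n) powr p)"
    then have "\<exists>f\<in>ell_space q. \<not> awcga_converges t \<delta> \<eta>
        (ell_space q :: 'a universe set) (ell_space_norm q) unit_dictionary f"
      unfolding \<open>p = q / (q - 1)\<close> by (intro awcga_diverges_if_summable assms)
    then show False
      using conv smooth_class_ell_space dictionary_unit_vectors assms(1,2) by blast
  qed
next
  assume div: "\<not> summable (\<lambda>n. t (Suc n) powr p)"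
  show "\<forall>(S :: 'a universe set) N D f.
    smooth_class q S N \<longrightarrow> dictionary S N D \<longrightarrow> f \<in> S \<longrightarrow> awcga_converges t \<delta> \<eta> S N D f"
  proof (intro allI impI)
    fix S :: "'a universe set" and N D f
    assume X: "smooth_class q S N" and D: "dictionary S N D" and f: "f \<in> S"
    from X obtain \<gamma> where "0 < \<gamma>" "\<And>u. 0 \<le> u \<Longrightarrow> modulus_of_smoothness S N u \<le> \<gamma> * u powr q"
      by (auto simp: smooth_class_def)
    with X assms(1) interpret smooth_space S N q \<gamma>
      by unfold_locales (auto simp: smooth_class_def banach_space_on_def)
    show "awcga_converges t \<delta> \<eta> S N D f"
      using D f assms(4-8) div[unfolded \<open>p = q / (q - 1)\<close>] by (rule awcga_converges_if_not_summable)
  qed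
qed

end
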